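(* There exist low degree polynomials $c_1(n,k)$, $c_2(n,k)$, $\tilde c(n,k)$ in $n$ and $k$ such that the following holds. Let $A\in\mathbb{R}^{n\times n}$ be nonsingular, $b\in\mathbb{R}^n$, and let preconditioned sketched GMRES (described in the context, with $x^{(0)}=0$, left preconditioner $M_L$ and right preconditioner $M_R$) be applied with a computed preconditioned basis $\hat Z_{1:m}\in\mathbb{R}^{n\times m}$ and a randomized subspace embedding $S\in\mathbb{R}^{s\times n}$ with distortion $\epsilon\in(0,1)$ for $m$-dimensional subspaces of $\mathbb{R}^n$, in the sense that the embedding inequality of the context holds with high probability. Assume that the computed quantities satisfy the rounding error model (W), (b), (C), (g), (LS), (x) of the context with parameters $\varepsilon_W,\varepsilon_b,\varepsilon_S,\varepsilon_{sls},\varepsilon_x$. If there exists $k\le m$ such that $$c_1(n,k)\,(\varepsilon_S+\varepsilon_{sls})\sqrt{\tfrac{1-\epsilon}{1+\epsilon}}\;\kappa\bigl([\phi\hat b,\ \hat W_{1:k}]\bigr)\ge 1\quad\text{for all }\phi>0,$$ $$\sqrt{k}\,c_2(n,k)\,(\varepsilon_S+\varepsilon_{sls})\sqrt{\tfrac{1+\epsilon}{1-\epsilon}}\;\kappa(\hat W_{1:k})\le \tfrac12,\qquad \varepsilon_x\,\kappa(\hat Z_{1:k})\le\tfrac12,$$ then, with high probability, $$\begin{aligned}\|b-A\hat x^{(k)}\|\le{}&\tilde c(n,k)\Bigl(\tfrac{1+\epsilon}{1-\epsilon}(\varepsilon_S+\varepsilon_{sls})+\varepsilon_W+\varepsilon_x\Bigr)\kappa(M_L)\,\kappa(\hat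 Z_{1:k})\,\|A\|_F\,\|\hat x^{(k)}\|\\&+\Bigl(\tfrac{1+\epsilon}{1-\epsilon}(1+\varepsilon_b)\bigl(\varepsilon_{sls}+(1+\varepsilon_{sls})\varepsilon_S\bigr)+\varepsilon_b\Bigr)\kappa(M_L)\,\|b\|.\end{aligned}$$ Furthermore, if $\varepsilon_W,\varepsilon_b,\varepsilon_{sls},\varepsilon_S,\varepsilon_x\le O(u)$, then (with high probability) $$\|b-A\hat x^{(k)}\|\le \tfrac{1+\epsilon}{1-\epsilon}\,O(u)\,\kappa(M_L)\bigl(\kappa(\hat Z_{1:k})\,\|A\|_F\,\|\hat x^{(k)}\|+\|b\|\bigr).$$
   Context: Notation. $\|\cdot\|$ is the Euclidean vector norm and the induced spectral matrix norm, $\|\cdot\|_F$ the Frobenius norm. $\sigma_{\min}(X)=\min_{\|v\|=1}\|Xv\|$, $\kappa(X)=\|X\|/\sigma_{\min}(X)$ (equal to $\infty$ if $\sigma_{\min}(X)=0$). $X_{1:i}$ denotes the first $i$ columns of $X$, and $X_j$ its $j$-th column. $u$ is the unit roundoff, and $O(u)$ denotes a quantity bounded by $u$ times a low degree polynomial in the dimensions. Hats denote computed quantities. The polynomials $c_1,c_2,\tilde c$ are positive and independent of all other data. Embedding inequality. For $\epsilon\in(0,1)$, $S\in\mathbb{R}^{s\times n}$ is an $\epsilon$-subspace embedding for a subspace $\mathcal V\subseteq\mathbb{R}^n$ if $(1-\epsilon)\|v\|^2\le\|Sv\|^2\le(1+\epsilon)\|v\|^2$ for all $v\in\mathcal V$.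 $S$ is drawn at random, and this holds with high probability for the subspaces the algorithm sketches. "With high probability" in the conclusion refers to the event that the embedding inequality holds on the span of the columns of $[\hat b,\hat W_{1:k}]$; the probability is not quantified. Preconditioned sketched GMRES for $Ax=b$ ($x^{(0)}=0$, nonsingular preconditioners $M_L,M_R$, $s>m$). At iteration $i\le m$: (1) from a (not necessarily orthogonal) basis $B_{1:i}$ of the Krylov space form $Z_{1:i}=M_R^{-1}B_{1:i}$ and $W_{1:i}=M_L^{-1}AZ_{1:i}$; (2) with $\tilde b=M_L^{-1}b$, form $g=S\tilde b$, $C_{1:i}=SW_{1:i}$ and solve $y^{(i)}=\arg\min_y\|g-C_{1:i}y\|$ by QR factorization; (3) set $x^{(i)}=Z_{1:i}y^{(i)}$. Rounding error model. The computed quantities satisfy, for $i\le m$ and nonnegative scalars $\varepsilon_W,\varepsilon_b,\varepsilon_S,\varepsilon_{sls},\varepsilon_x$: (W) $\hat W_{1:i}=M_L^{-1}A\hat Z_{1:i}+\Delta W_{1:i}$, $\|\Delta W_{1:i}\|_F\le\varepsilon_W\|M_L^{-1}\|\,\|A\|_F\,\|\hat Z_{1:i}\|_F$; (b) $\hat b=M_L^{-1}b+\Delta b$, $\|\Delta b\|\le\varepsilon_b\|M_L^{-1}\|\,\|b\|$; (C) $\hat C_{1:i}=S\hat W_{1:i}+\Delta C_{1:i}$, $\|\Delta C_j\|\le\varepsilon_S\|S\hat W_j\|$ for all $j\le i$; (g) $\hat g=S\hat b+\Delta g$, $\|\Delta g\|\le\varepsilon_S\|S\hat b\|$; (LS)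 $\hat y^{(i)}=\arg\min_y\|\hat g+\Delta\hat g-(\hat C_{1:i}+\Delta\hat C_{1:i})y\|$ with $\|[\Delta\hat g,\ \Delta\hat C_{1:i}]e_j\|\le\varepsilon_{sls}\|[\hat g,\ \hat C_{1:i}]e_j\|$ for all $j\le i+1$; (x) $\hat x^{(i)}=\hat Z_{1:i}\hat y^{(i)}+\Delta x^{(i)}$, $\|\Delta x^{(i)}\|\le\varepsilon_x\|\hat Z_{1:i}\|\,\|\hat y^{(i)}\|$. In the paper the parameters $\varepsilon_W,\varepsilon_{sls},\varepsilon_x$ are taken to be of order $O(u)$ by standard rounding error analysis. *)

theory Defs
  imports
    "HOL-Probability.Probability_Measure"
    "Jordan_Normal_Form.Gauss_Jordan_Elimination"
    "Jordan_Normal_Form.VS_Connect"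
begin

(* Dimensions are quantified inside the theorem (the polynomials come first), so matrices and
   vectors are the carrier-based ones of Jordan_Normal_Form, with columns counted from 0. *)

hide_type (open) Finite_Cartesian_Product.vec
hide_const (open) Finite_Cartesian_Product.vec

section \<open>Norms, condition number, column blocks\<close>

definition vnorm :: "real vec \<Rightarrow> real" where
  "vnorm v = sqrt (v \<bullet> v)"

definition spec_norm :: "real mat \<Rightarrow> real" where
  "spec_norm X = Sup {vnorm (X *\<^sub>v v) | v. v \<in> carrier_vec (dim_col X) \<and> vnorm v = 1}"

definition sigma_min :: "real mat \<Rightarrow> real" where
  "sigma_min X = Inf {vnorm (X *\<^sub>v v) | v. v \<in> carrier_vec (dim_col X) \<and> vnorm v = 1}"

definition frob_norm :: "real mat \<Rightarrow> real" where
  "frob_norm X = sqrt (\<Sum>i<dim_row X. \<Sum>j<dim_col X. (X $$ (i, j))\<^sup>2)"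

definition cond :: "real mat \<Rightarrow> ereal" where
  "cond X = (if sigma_min X = 0 then \<infinity> else ereal (spec_norm X / sigma_min X))"

definition mat_inv :: "real mat \<Rightarrow> real mat" where
  "mat_inv M = the (mat_inverse M)"

definition first_cols :: "nat \<Rightarrow> real mat \<Rightarrow> real mat" where
  "first_cols i X = mat_of_cols (dim_row X) (take i (cols X))"

(* the block matrix [v, X] *)
definition augment :: "real vec \<Rightarrow> real mat \<Rightarrow> real mat" where
  "augment v X = mat_of_cols (dim_vec v) (v # cols X)"

section \<open>Polynomial functions of bounded degree\<close>

(* "poly_fun_deg d f": f is a polynomial function of total degree at most d.  The clauses are those
   of real_polynomial_function in HOL-Analysis, with the degree recorded. *)
inductive poly_fun_deg :: "nat \<Rightarrow> ('a::real_normed_vector \<Rightarrow> real) \<Rightarrow> bool" where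
  linear: "bounded_linear f \<Longrightarrow> poly_fun_deg 1 f"
| const: "poly_fun_deg d (\<lambda>x. c)"
| add: "poly_fun_deg d f \<Longrightarrow> poly_fun_deg d g \<Longrightarrow> poly_fun_deg d (\<lambda>x. f x + g x)"
| mult: "poly_fun_deg d f \<Longrightarrow> poly_fun_deg e g \<Longrightarrow> poly_fun_deg (d + e) (\<lambda>x. f x * g x)"

(* degree at most 2, no more than a concrete meaning for "low degree" *)
definition low_degree_pos_poly :: "(real \<times> real \<Rightarrow> real) \<Rightarrow> bool" where
  "low_degree_pos_poly c \<longleftrightarrow>
     poly_fun_deg 2 c \<and> (\<forall>n k :: nat. 1 \<le> n \<longrightarrow> 1 \<le> k \<longrightarrow> 0 < c (real n, real k))"

section \<open>Random sketching\<close>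

definition subspace_embedding :: "real \<Rightarrow> real mat \<Rightarrow> real vec set \<Rightarrow> bool" where
  "subspace_embedding \<epsilon> S V \<longleftrightarrow>
     (\<forall>v\<in>V. (1 - \<epsilon>) * (vnorm v)\<^sup>2 \<le> (vnorm (S *\<^sub>v v))\<^sup>2 \<and>
             (vnorm (S *\<^sub>v v))\<^sup>2 \<le> (1 + \<epsilon>) * (vnorm v)\<^sup>2)"

(* The set where Q holds need not be measurable, hence the event E inside it. *)
definition holds_with_prob :: "'s measure \<Rightarrow> real \<Rightarrow> ('s \<Rightarrow> bool) \<Rightarrow> bool" where
  "holds_with_prob D q Q \<longleftrightarrow> (\<exists>E\<in>sets D. q \<le> measure D E \<and> (\<forall>S\<in>E. Q S))"

section \<open>Sketched GMRES in finite precision\<close>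

(* The computed quantities of one run; y and x are indexed by the iteration. *)
record sgmres_run =
  Zh :: "real mat"
  Wh :: "real mat"
  bh :: "real vec"
  gh :: "real vec"
  Ch :: "real mat"
  yh :: "nat \<Rightarrow> real vec"
  xh :: "nat \<Rightarrow> real vec"

record rounding_params =
  eW :: real
  eb :: real
  eS :: real
  esls :: real
  ex :: real

definition run_dims :: "nat \<Rightarrow> nat \<Rightarrow> nat \<Rightarrow> sgmres_run \<Rightarrow> bool" where
  "run_dims n s m r \<longleftrightarrow>
     Zh r \<in> carrier_mat n m \<and> Wh r \<in> carrier_mat n m \<and> bh r \<in> carrier_vec n \<and>
     gh r \<in> carrier_vec s \<and> Ch r \<in> carrier_mat s m \<and>
     (\<forall>i\<in>{1..m}. yh r i \<in> carrier_vec i \<and> xh r i \<in> carrier_vec n)"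

definition rounding_W where
  "rounding_W A ML \<epsilon>W r i \<longleftrightarrow>
     frob_norm (first_cols i (Wh r) - mat_inv ML * A * first_cols i (Zh r))
       \<le> \<epsilon>W * spec_norm (mat_inv ML) * frob_norm A * frob_norm (first_cols i (Zh r))"

definition rounding_b where
  "rounding_b b ML \<epsilon>b r \<longleftrightarrow>
     vnorm (bh r - mat_inv ML *\<^sub>v b) \<le> \<epsilon>b * spec_norm (mat_inv ML) * vnorm b"

definition rounding_C where
  "rounding_C S \<epsilon>S r j \<longleftrightarrow>
     vnorm (col (Ch r) j - S *\<^sub>v col (Wh r) j) \<le> \<epsilon>S * vnorm (S *\<^sub>v col (Wh r) j)"

definition rounding_g where
  "rounding_g S \<epsilon>S r \<longleftrightarrow> vnorm (gh r - S *\<^sub>v bh r) \<le> \<epsilon>S * vnorm (S *\<^sub>v bh r)"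

(* dg and dC may depend on the iteration i *)
definition rounding_LS where
  "rounding_LS \<epsilon>sls r i \<longleftrightarrow>
     (\<exists>dg\<in>carrier_vec (dim_vec (gh r)). \<exists>dC\<in>carrier_mat (dim_row (Ch r)) i.
        (\<forall>j<i + 1. vnorm (col (augment dg dC) j)
                     \<le> \<epsilon>sls * vnorm (col (augment (gh r) (first_cols i (Ch r))) j)) \<and>
        is_arg_min (\<lambda>y. vnorm ((gh r + dg) - (first_cols i (Ch r) + dC) *\<^sub>v y))
                   (\<lambda>y. y \<in> carrier_vec i) (yh r i))"

definition rounding_x where
  "rounding_x \<epsilon>x r i \<longleftrightarrow>
     vnorm (xh r i - first_cols i (Zh r) *\<^sub>v yh r i)
       \<le> \<epsilon>x * spec_norm (first_cols i (Zh r)) * vnorm (yh r i)"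

definition rounding_model ::
  "nat \<Rightarrow> real mat \<Rightarrow> real vec \<Rightarrow> real mat \<Rightarrow> real mat \<Rightarrow> rounding_params \<Rightarrow> sgmres_run \<Rightarrow> bool" where
  "rounding_model m A b ML S e r \<longleftrightarrow>
     (\<forall>i\<in>{1..m}. rounding_W A ML (eW e) r i) \<and>
     rounding_b b ML (eb e) r \<and>
     (\<forall>j<m. rounding_C S (eS e) r j) \<and>
     rounding_g S (eS e) r \<and>
     (\<forall>i\<in>{1..m}. rounding_LS (esls e) r i) \<and>
     (\<forall>i\<in>{1..m}. rounding_x (ex e) r i)"

(* D is the distribution of the random sketching matrix S; R S is the run of the algorithm with
   sketching matrix S, so that every computed quantity, the basis included, may depend on S. *)
definition sgmres_setting ::
  "nat \<Rightarrow> nat \<Rightarrow> nat \<Rightarrow> real mat \<Rightarrow> real vec \<Rightarrow> real mat \<Rightarrow> real mat \<Rightarrow> real \<Rightarrow> real mat measure \<Rightarrow>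
   rounding_params \<Rightarrow> (real mat \<Rightarrow> sgmres_run) \<Rightarrow> bool" where
  "sgmres_setting n s m A b ML MR \<epsilon> D e R \<longleftrightarrow>
     1 \<le> n \<and> m < s \<and>
     A \<in> carrier_mat n n \<and> invertible_mat A \<and> b \<in> carrier_vec n \<and>
     ML \<in> carrier_mat n n \<and> invertible_mat ML \<and> MR \<in> carrier_mat n n \<and> invertible_mat MR \<and>
     0 < \<epsilon> \<and> \<epsilon> < 1 \<and>
     0 \<le> eW e \<and> 0 \<le> eb e \<and> 0 \<le> eS e \<and> 0 \<le> esls e \<and> 0 \<le> ex e \<and>
     prob_space D \<and> space D \<subseteq> carrier_mat s n \<and>
     (\<forall>S\<in>space D. run_dims n s m (R S) \<and> rounding_model m A b ML S e (R S))"

definition sketch_event :: "nat \<Rightarrow> real \<Rightarrow> real mat \<Rightarrow> sgmres_run \<Rightarrow> nat \<Rightarrow> bool" where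
  "sketch_event n \<epsilon> S r k \<longleftrightarrow>
     subspace_embedding \<epsilon> S (vec_space.col_space n (augment (bh r) (first_cols k (Wh r))))"

(* The arguments c1, c2 are the values of the polynomials at (n, k).  In ereal, 0 * \<infinity> = 0; the
   separate requirement cond (...) \<noteq> \<infinity> keeps the last condition from holding for a rank
   deficient basis when ex e = 0.  In the second condition this needs no separate requirement,
   because the first one forces eS e + esls e > 0. *)
definition critical_iteration ::
  "real \<Rightarrow> real \<Rightarrow> real \<Rightarrow> rounding_params \<Rightarrow> sgmres_run \<Rightarrow> nat \<Rightarrow> bool" where
  "critical_iteration c1 c2 \<epsilon> e r k \<longleftrightarrow>
     (\<forall>\<phi>>0. ereal (c1 * (eS e + esls e) * sqrt ((1 - \<epsilon>) / (1 + \<epsilon>)))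
              * cond (augment (\<phi> \<cdot>\<^sub>v bh r) (first_cols k (Wh r))) \<ge> 1) \<and>
     ereal (sqrt (real k) * c2 * (eS e + esls e) * sqrt ((1 + \<epsilon>) / (1 - \<epsilon>)))
       * cond (first_cols k (Wh r)) \<le> ereal (1 / 2) \<and>
     cond (first_cols k (Zh r)) \<noteq> \<infinity> \<and>
     ereal (ex e) * cond (first_cols k (Zh r)) \<le> ereal (1 / 2)"

end

theory Submission
  imports Defs
begin

text \<open>
  Write \<open>W\<close> for the first \<open>k\<close> computed columns, \<open>c\<close> for the computed preconditioned right-hand side,
  \<open>g\<close> and \<open>C\<close> for their sketched images including all perturbations, \<open>y\<close> for the exact minimiser of
  \<open>\<parallel>g - C y\<parallel>\<close>, \<open>r = g - C y\<close>, \<open>\<mu> = \<epsilon>\<^sub>S + \<epsilon>\<^sub>s\<^sub>l\<^sub>s\<close>, \<open>L = sqrt (1 - \<epsilon>)\<close> and \<open>\<rho> = sqrt (1 + \<epsilon>)\<close>.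
  Since \<open>b - A x\<close> equals \<open>M\<^sub>L (c - W y)\<close> up to perturbations that the rounding model bounds directly
  (\<open>true_residual_le\<close>), everything depends on a bound for \<open>c - W y\<close>, and by the embedding inequality on
  one for \<open>r\<close>.  For small \<open>\<epsilon>\<close> the perturbations alone exhaust the term in \<open>\<parallel>b\<parallel>\<close> that the theorem allows,
  so \<open>r\<close> must be bounded by a multiple of \<open>\<mu> \<parallel>W\<parallel> \<parallel>y\<parallel>\<close>, without any contribution from \<open>b\<close>.

  This is where the critical iteration enters: there \<open>[\<phi> c, W]\<close> is numerically singular for every
  \<open>\<phi>\<close>, while \<open>W\<close> itself is well conditioned.  A near null vector \<open>(a, w)\<close> of \<open>[\<phi> c, W]\<close> is one of
  \<open>[\<phi> g, C]\<close> too, because sketching changes norms by bounded factors and the perturbations are small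
  column by column.  Optimality of \<open>y\<close> then says \<open>\<bar>a\<bar> \<phi> \<parallel>r\<parallel> \<le> \<parallel>a \<phi> g + C w\<parallel>\<close>, and since \<open>C\<close> has no near
  null vectors of its own, \<open>w\<close> is close to \<open>- a \<phi> y\<close>; for \<open>\<phi> \<parallel>y\<parallel> \<le> 1\<close> this keeps \<open>\<bar>a\<bar>\<close> away from zero
  (\<open>residual_le_of_near_null_vector\<close>).

  What remains is to choose \<open>\<phi>\<close>.  With \<open>1 / \<phi> = \<parallel>y\<parallel> + \<parallel>g\<parallel> / (\<rho> \<parallel>W\<parallel>)\<close> the norm of \<open>[\<phi> c, W]\<close> is at most
  \<open>3 (\<rho> / L) \<parallel>W\<parallel>\<close>, and the factor \<open>\<rho> / L\<close> is cancelled by the square root in the first criticality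
  condition.  The outcome is \<open>\<parallel>r\<parallel> \<le> const \<surd>k \<mu> (\<rho> \<parallel>W\<parallel> \<parallel>y\<parallel> + \<parallel>g\<parallel>)\<close>, where \<open>\<parallel>g\<parallel> \<le> \<parallel>C y\<parallel> + \<parallel>r\<parallel>\<close> is absorbed by
  means of the second condition (\<open>sketched_residual_le\<close>).  Scaling with \<open>\<parallel>g\<parallel>\<close> instead of \<open>\<parallel>c\<parallel>\<close> matters:
  \<open>\<parallel>c\<parallel>\<close> would cost a further factor \<open>\<rho> / L\<close>, leaving a product \<open>(\<rho> / L)\<^sup>2 \<mu> \<epsilon>\<^sub>W\<close> that neither the
  hypotheses nor the claimed bound control, whereas \<open>(\<rho> / L) \<mu>\<close> is small by the second condition.

  Finally \<open>\<epsilon>\<^sub>x \<kappa>(Z) \<le> 1/2\<close> converts \<open>\<parallel>Z\<parallel> \<parallel>y\<parallel>\<close> into \<open>2 \<kappa>(Z) \<parallel>x\<parallel>\<close>.  The three polynomials come out as \<open>1\<close>,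
  \<open>96\<close> and \<open>400 k\<close>.  The argument is deterministic on the event that the embedding inequality
  holds, so the probabilistic claim holds on the same event.
\<close>

section \<open>The Euclidean norm\<close>

lemma vnorm_eq_L2_set: "vnorm v = L2_set (\<lambda>i. v $ i) {..<dim_vec v}"
  by (simp add: vnorm_def L2_set_def scalar_prod_def power2_eq_square atLeast0LessThan)

lemma vnorm_nonneg [simp]: "0 \<le> vnorm v"
  by (simp add: vnorm_eq_L2_set)

lemma vnorm_zero_vec [simp]: "vnorm (0\<^sub>v n) = 0"
  by (simp add: vnorm_def)

lemma vnorm_smult: "vnorm (c \<cdot>\<^sub>v v) = \<bar>c\<bar> * vnorm v"
proof -
  have "(c \<cdot>\<^sub>v v) \<bullet> (c \<cdot>\<^sub>v v) = c\<^sup>2 * (v \<bullet> v)"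
    by (simp add: power2_eq_square)
  then show ?thesis
    by (simp add: vnorm_def real_sqrt_mult)
qed

lemma vnorm_add_le:
  assumes "v \<in> carrier_vec n" "w \<in> carrier_vec n"
  shows "vnorm (v + w) \<le> vnorm v + vnorm w"
proof -
  have "vnorm (v + w) = L2_set (\<lambda>i. v $ i + w $ i) {..<n}"
    unfolding vnorm_eq_L2_set using assms by (intro L2_set_cong) auto
  also have "\<dots> \<le> L2_set (\<lambda>i. v $ i) {..<n} + L2_set (\<lambda>i. w $ i) {..<n}"
    by (rule L2_set_triangle_ineq)
  finally show ?thesis
    using assms by (simp add: vnorm_eq_L2_set)
qed

lemma vnorm_minus_commute:
  assumes "v \<in> carrier_vec n" "w \<in> carrier_vec n"
  shows "vnorm (v - w) = vnorm (w - v)"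
proof -
  have "v - w = (-1) \<cdot>\<^sub>v (w - v)"
    using assms by (intro eq_vecI) auto
  then show ?thesis
    by (simp add: vnorm_smult)
qed

lemma vnorm_diff_triangle:
  assumes "u \<in> carrier_vec n" "v \<in> carrier_vec n" "w \<in> carrier_vec n"
  shows "vnorm (u - w) \<le> vnorm (u - v) + vnorm (v - w)"
proof -
  have "u - w = (u - v) + (v - w)"
    using assms by (intro eq_vecI) auto
  then show ?thesis
    using assms vnorm_add_le[of "u - v" n "v - w"] by simp
qed

lemma vnorm_le_add_diff:
  assumes "v \<in> carrier_vec n" "w \<in> carrier_vec n"
  shows "vnorm v \<le> vnorm w + vnorm (v - w)"
  using vnorm_diff_triangle[of v n w "0\<^sub>v n"] assms by (simp add: add.commute)

lemma vnorm_diff_le: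
  assumes "v \<in> carrier_vec n" "w \<in> carrier_vec n"
  shows "vnorm (v - w) \<le> vnorm v + vnorm w"
  using vnorm_diff_triangle[of v n "0\<^sub>v n" w] assms
    vnorm_minus_commute[of "0\<^sub>v n" n w] by simp

lemma vnorm_unit_vec: "i < n \<Longrightarrow> vnorm (unit_vec n i) = 1"
  by (simp add: vnorm_def)

lemma vnorm_vCons_sq: "(vnorm (vCons a w))\<^sup>2 = a\<^sup>2 + (vnorm w)\<^sup>2"
proof -
  have "0 \<le> w \<bullet> w" by (simp add: scalar_prod_def sum_nonneg)
  then show ?thesis by (simp add: vnorm_def power2_eq_square)
qed

lemma vnorm_vCons_eq_1D:
  assumes "vnorm (vCons a w) = 1"
  shows "\<bar>a\<bar> \<le> 1" "vnorm w \<le> 1" "1 \<le> \<bar>a\<bar> + vnorm w"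
proof -
  have unit: "a\<^sup>2 + (vnorm w)\<^sup>2 = 1" using vnorm_vCons_sq[of a w] assms by simp
  then have "a\<^sup>2 \<le> 1" "(vnorm w)\<^sup>2 \<le> 1"
    using zero_le_power2[of a] zero_le_power2[of "vnorm w"] by linarith+
  then show "\<bar>a\<bar> \<le> 1" "vnorm w \<le> 1"
    using abs_square_le_1[of a] abs_square_le_1[of "vnorm w"] by simp_all
  have "1\<^sup>2 \<le> (\<bar>a\<bar> + vnorm w)\<^sup>2" using unit by (simp add: power2_sum)
  then show "1 \<le> \<bar>a\<bar> + vnorm w" by (rule power2_le_imp_le) simp
qed

section \<open>Frobenius and spectral norm, smallest singular value\<close>

lemma frob_norm_nonneg [simp]: "0 \<le> frob_norm X"
  by (simp add: frob_norm_def sum_nonneg)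

lemma scalar_prod_sq_le: "(v \<bullet> w)\<^sup>2 \<le> (\<Sum>j<dim_vec w. (v $ j)\<^sup>2) * (vnorm w)\<^sup>2"
proof -
  have "\<bar>v \<bullet> w\<bar> \<le> (\<Sum>j<dim_vec w. \<bar>v $ j\<bar> * \<bar>w $ j\<bar>)"
    unfolding scalar_prod_def atLeast0LessThan
    by (rule order_trans[OF sum_abs]) (simp add: abs_mult)
  also have "\<dots> \<le> L2_set (\<lambda>j. v $ j) {..<dim_vec w} * vnorm w"
    unfolding vnorm_eq_L2_set by (rule L2_set_mult_ineq)
  finally have "\<bar>v \<bullet> w\<bar>\<^sup>2 \<le> (L2_set (\<lambda>j. v $ j) {..<dim_vec w} * vnorm w)\<^sup>2"
    by (rule power_mono) simp
  then show ?thesis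
    by (simp add: power_mult_distrib L2_set_def sum_nonneg)
qed

lemma vnorm_mult_le_frob_norm:
  assumes "v \<in> carrier_vec (dim_col X)"
  shows "vnorm (X *\<^sub>v v) \<le> frob_norm X * vnorm v"
proof -
  have "(vnorm (X *\<^sub>v v))\<^sup>2 = (\<Sum>i<dim_row X. (row X i \<bullet> v)\<^sup>2)"
    by (simp add: vnorm_eq_L2_set L2_set_def sum_nonneg)
  also have "\<dots> \<le> (\<Sum>i<dim_row X. (\<Sum>j<dim_col X. (X $$ (i, j))\<^sup>2) * (vnorm v)\<^sup>2)"
  proof (rule sum_mono)
    fix i assume "i \<in> {..<dim_row X}"
    then show "(row X i \<bullet> v)\<^sup>2 \<le> (\<Sum>j<dim_col X. (X $$ (i, j))\<^sup>2) * (vnorm v)\<^sup>2"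
      using assms scalar_prod_sq_le[of "row X i" v] by simp
  qed
  also have "\<dots> = (frob_norm X * vnorm v)\<^sup>2"
    by (simp add: frob_norm_def power_mult_distrib sum_nonneg sum_distrib_right)
  finally show ?thesis
    by (rule power2_le_imp_le) simp
qed

text \<open>Boundedness of the image of the unit sphere is what makes the supremum meaningful.\<close>

lemma unit_le_spec_norm:
  assumes "v \<in> carrier_vec (dim_col X)" "vnorm v = 1"
  shows "vnorm (X *\<^sub>v v) \<le> spec_norm X"
  unfolding spec_norm_def
proof (rule cSup_upper)
  show "bdd_above {vnorm (X *\<^sub>v v) |v. v \<in> carrier_vec (dim_col X) \<and> vnorm v = 1}"
  proof (rule bdd_aboveI)
    fix t assume "t \<in> {vnorm (X *\<^sub>v v) |v. v \<in> carrier_vec (dim_col X) \<and> vnorm v = 1}"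
    then show "t \<le> frob_norm X"
      using vnorm_mult_le_frob_norm by fastforce
  qed
qed (use assms in blast)

lemma unit_sphere_nonempty:
  assumes "0 < dim_col X"
  shows "{vnorm (X *\<^sub>v v) |v. v \<in> carrier_vec (dim_col X) \<and> vnorm v = 1} \<noteq> {}"
  using assms vnorm_unit_vec[of 0 "dim_col X"] unit_vec_carrier[of "dim_col X" 0] by blast

lemma sigma_min_le_unit:
  assumes "v \<in> carrier_vec (dim_col X)" "vnorm v = 1"
  shows "sigma_min X \<le> vnorm (X *\<^sub>v v)"
  unfolding sigma_min_def
proof (rule cInf_lower)
  show "bdd_below {vnorm (X *\<^sub>v v) |v. v \<in> carrier_vec (dim_col X) \<and> vnorm v = 1}"
    by (rule bdd_belowI[of _ 0]) auto
qed (use assms in blast)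

lemma sigma_min_nonneg:
  assumes "0 < dim_col X"
  shows "0 \<le> sigma_min X"
  unfolding sigma_min_def
  by (rule cInf_greatest[OF unit_sphere_nonempty[OF assms]]) auto

lemma sigma_min_le_spec_norm:
  assumes "0 < dim_col X"
  shows "sigma_min X \<le> spec_norm X"
  using assms sigma_min_le_unit[of "unit_vec (dim_col X) 0" X]
    unit_le_spec_norm[of "unit_vec (dim_col X) 0" X] vnorm_unit_vec[of 0 "dim_col X"]
  by (simp add: unit_vec_carrier)

lemma spec_norm_nonneg: "0 < dim_col X \<Longrightarrow> 0 \<le> spec_norm X"
  using sigma_min_nonneg sigma_min_le_spec_norm order_trans by blast

lemma normalize_vec:
  assumes "v \<in> carrier_vec (dim_col X)" "vnorm v \<noteq> 0"
  shows "vnorm ((1 / vnorm v) \<cdot>\<^sub>v v) = 1"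
    and "vnorm (X *\<^sub>v ((1 / vnorm v) \<cdot>\<^sub>v v)) = vnorm (X *\<^sub>v v) / vnorm v"
proof -
  show "vnorm ((1 / vnorm v) \<cdot>\<^sub>v v) = 1"
    using assms(2) by (simp add: vnorm_smult)
  have "X *\<^sub>v ((1 / vnorm v) \<cdot>\<^sub>v v) = (1 / vnorm v) \<cdot>\<^sub>v (X *\<^sub>v v)"
    by (rule mult_mat_vec[OF carrier_matI[OF refl refl] assms(1)])
  then show "vnorm (X *\<^sub>v ((1 / vnorm v) \<cdot>\<^sub>v v)) = vnorm (X *\<^sub>v v) / vnorm v"
    by (simp add: vnorm_smult)
qed

lemma vnorm_mult_le_spec_norm:
  assumes "v \<in> carrier_vec (dim_col X)"
  shows "vnorm (X *\<^sub>v v) \<le> spec_norm X * vnorm v"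
proof (cases "vnorm v = 0")
  case True
  then show ?thesis
    using vnorm_mult_le_frob_norm[OF assms] by simp
next
  case False
  then have "0 < vnorm v" by (simp add: less_le)
  with False show ?thesis
    using normalize_vec[OF assms False] assms
      unit_le_spec_norm[of "(1 / vnorm v) \<cdot>\<^sub>v v" X]
    by (simp add: pos_divide_le_eq)
qed

lemma sigma_min_mult_le:
  assumes "v \<in> carrier_vec (dim_col X)"
  shows "sigma_min X * vnorm v \<le> vnorm (X *\<^sub>v v)"
proof (cases "vnorm v = 0")
  case False
  then have "0 < vnorm v" by (simp add: less_le)
  with False show ?thesis
    using normalize_vec[OF assms False] assms
      sigma_min_le_unit[of "(1 / vnorm v) \<cdot>\<^sub>v v" X]
    by (simp add: pos_le_divide_eq)
qed simp

lemma spec_norm_le: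
  assumes "0 < dim_col X"
    and "\<And>v. v \<in> carrier_vec (dim_col X) \<Longrightarrow> vnorm v = 1 \<Longrightarrow> vnorm (X *\<^sub>v v) \<le> c"
  shows "spec_norm X \<le> c"
  unfolding spec_norm_def
  by (rule cSup_least[OF unit_sphere_nonempty[OF assms(1)]]) (use assms(2) in blast)

lemma spec_norm_le_frob_norm:
  assumes "0 < dim_col X"
  shows "spec_norm X \<le> frob_norm X"
  using assms vnorm_mult_le_frob_norm[of _ X] by (intro spec_norm_le) force+

text \<open>The infimum is approximated rather than attained here; this spares a compactness argument, at
  the price of the factor 2 in \<open>near_null_vector_of_cond\<close>.\<close>

lemma sigma_min_approx:
  assumes "0 < dim_col X" "sigma_min X < c"
  obtains v where "v \<in> carrier_vec (dim_col X)" "vnorm v = 1" "vnorm (X *\<^sub>v v) < c"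
  using assms cInf_lessD[OF unit_sphere_nonempty[OF assms(1)]]
  unfolding sigma_min_def by blast

lemma frob_norm_sq_cols: "(frob_norm X)\<^sup>2 = (\<Sum>j<dim_col X. (vnorm (col X j))\<^sup>2)"
proof -
  have "(frob_norm X)\<^sup>2 = (\<Sum>i<dim_row X. \<Sum>j<dim_col X. (X $$ (i, j))\<^sup>2)"
    by (simp add: frob_norm_def sum_nonneg)
  also have "\<dots> = (\<Sum>j<dim_col X. \<Sum>i<dim_row X. (X $$ (i, j))\<^sup>2)"
    by (rule sum.swap)
  finally show ?thesis
    by (simp add: vnorm_eq_L2_set L2_set_def sum_nonneg)
qed

text \<open>Turns the columnwise relative perturbation bounds of the rounding model into a normwise one.\<close>

lemma frob_norm_le_columnwise:
  assumes "dim_col X = dim_col Y" "0 \<le> c"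
    and "\<And>j. j < dim_col Y \<Longrightarrow> vnorm (col X j) \<le> c * vnorm (col Y j)"
  shows "frob_norm X \<le> c * frob_norm Y"
proof (rule power2_le_imp_le)
  have "(frob_norm X)\<^sup>2 \<le> (\<Sum>j<dim_col Y. (c * vnorm (col Y j))\<^sup>2)"
    unfolding frob_norm_sq_cols assms(1) by (intro sum_mono power_mono) (auto intro: assms)
  also have "\<dots> = (c * frob_norm Y)\<^sup>2"
    by (simp add: power_mult_distrib frob_norm_sq_cols sum_distrib_left)
  finally show "(frob_norm X)\<^sup>2 \<le> (c * frob_norm Y)\<^sup>2" .
qed (use assms in simp)

lemma mult_unit_vec: "j < dim_col (X :: real mat) \<Longrightarrow> X *\<^sub>v unit_vec (dim_col X) j = col X j"
  by (intro eq_vecI) auto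

lemma frob_norm_le_spec_norm:
  assumes "0 < dim_col X"
  shows "frob_norm X \<le> sqrt (real (dim_col X)) * spec_norm X"
proof (rule power2_le_imp_le)
  have "(frob_norm X)\<^sup>2 \<le> (\<Sum>j<dim_col X. (spec_norm X)\<^sup>2)"
    unfolding frob_norm_sq_cols
  proof (intro sum_mono power_mono)
    fix j assume "j \<in> {..<dim_col X}"
    then show "vnorm (col X j) \<le> spec_norm X"
      using unit_le_spec_norm[of "unit_vec (dim_col X) j" X]
      by (simp add: mult_unit_vec vnorm_unit_vec unit_vec_carrier)
  qed simp
  also have "\<dots> = (sqrt (real (dim_col X)) * spec_norm X)\<^sup>2"
    by (simp add: power_mult_distrib)
  finally show "(frob_norm X)\<^sup>2 \<le> (sqrt (real (dim_col X)) * spec_norm X)\<^sup>2" .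
qed (simp add: spec_norm_nonneg assms)

lemma frob_norm_mult_le:
  assumes "dim_col X = dim_row Y" "0 < dim_col X"
  shows "frob_norm (X * Y) \<le> spec_norm X * frob_norm Y"
proof (rule frob_norm_le_columnwise)
  fix j assume "j < dim_col Y"
  then have "col (X * Y) j = X *\<^sub>v col Y j"
    using assms by (intro eq_vecI) auto
  then show "vnorm (col (X * Y) j) \<le> spec_norm X * vnorm (col Y j)"
    using assms by (simp add: vnorm_mult_le_spec_norm carrier_vecI)
qed (use assms in \<open>auto simp: spec_norm_nonneg\<close>)

lemma frob_norm_add_le:
  assumes "X \<in> carrier_mat n k" "Y \<in> carrier_mat n k"
  shows "frob_norm X \<le> frob_norm Y + frob_norm (X - Y)"
proof -
  have L2: "frob_norm Z = L2_set (\<lambda>p. Z $$ p) ({..<n} \<times> {..<k})" if "Z \<in> carrier_mat n k" for Z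
    using that by (simp add: frob_norm_def L2_set_def sum.cartesian_product)
  have "L2_set (\<lambda>p. X $$ p) ({..<n} \<times> {..<k})
      = L2_set (\<lambda>p. Y $$ p + (X - Y) $$ p) ({..<n} \<times> {..<k})"
    using assms by (intro L2_set_cong) auto
  also have "\<dots> \<le> L2_set (\<lambda>p. Y $$ p) ({..<n} \<times> {..<k})
      + L2_set (\<lambda>p. (X - Y) $$ p) ({..<n} \<times> {..<k})"
    by (rule L2_set_triangle_ineq)
  finally show ?thesis
    using assms by (simp add: L2 minus_carrier_mat)
qed

section \<open>The condition number\<close>

lemma cond_finiteD:
  assumes "cond X \<noteq> \<infinity>" "0 < dim_col X"
  shows "0 < sigma_min X" "cond X = ereal (spec_norm X / sigma_min X)"
    "1 \<le> spec_norm X / sigma_min X"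
proof -
  from assms have "sigma_min X \<noteq> 0" by (auto simp: cond_def)
  with sigma_min_nonneg[OF assms(2)] show pos: "0 < sigma_min X" by simp
  then show "cond X = ereal (spec_norm X / sigma_min X)" by (simp add: cond_def)
  show "1 \<le> spec_norm X / sigma_min X"
    using pos sigma_min_le_spec_norm[OF assms(2)] by simp
qed

lemma mat_inv_props:
  assumes "M \<in> carrier_mat n n" "invertible_mat M"
  shows "mat_inv M \<in> carrier_mat n n" "M * mat_inv M = 1\<^sub>m n" "mat_inv M * M = 1\<^sub>m n"
proof -
  from assms obtain B where "M * B = 1\<^sub>m n" "B * M = 1\<^sub>m (dim_row B)"
    by (auto simp: invertible_mat_def inverts_mat_def)
  moreover from this have "dim_col B = n" "dim_row B = n"
    using assms(1) by (metis carrier_matD(2) index_mult_mat(3) index_one_mat(3))+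
  ultimately have "M \<in> Units (ring_mat TYPE(real) n (0::nat))"
    using assms(1) by (auto simp: Units_def ring_mat_def intro!: bexI[of _ B])
  then have "mat_inverse M \<noteq> None"
    using mat_inverse(1)[OF assms(1), where b = "0::nat"] by blast
  then show "mat_inv M \<in> carrier_mat n n" "M * mat_inv M = 1\<^sub>m n" "mat_inv M * M = 1\<^sub>m n"
    using mat_inverse(2)[OF assms(1)] by (auto simp: mat_inv_def)
qed

text \<open>The rounding model speaks of \<open>\<parallel>M\<^sup>-\<^sup>1\<parallel>\<close>, the theorem of \<open>\<sigma>\<^sub>m\<^sub>i\<^sub>n(M)\<close>.  Finiteness of the condition number is
  part of the claim: a smallest singular value of zero would make \<open>M\<^sup>-\<^sup>1\<close> unbounded.\<close>

lemma spec_norm_mult_inv_le_cond: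
  assumes M: "M \<in> carrier_mat n n" "invertible_mat M" and n: "0 < n"
  shows "cond M = ereal (spec_norm M / sigma_min M)" "0 < sigma_min M"
    "spec_norm M * spec_norm (mat_inv M) \<le> spec_norm M / sigma_min M"
    "1 \<le> spec_norm M / sigma_min M"
proof -
  note I = mat_inv_props[OF M]
  have "1 \<le> spec_norm (mat_inv M) * sigma_min M"
  proof (rule field_le_epsilon)
    fix e :: real assume e: "0 < e"
    have P: "0 \<le> spec_norm (mat_inv M)"
      using I(1) n by (intro spec_norm_nonneg) auto
    define d where "d = e / (spec_norm (mat_inv M) + 1)"
    have d: "0 < d" "spec_norm (mat_inv M) * d \<le> e"
      using e P by (simp_all add: d_def field_simps)
    obtain v where v: "v \<in> carrier_vec (dim_col M)" "vnorm v = 1"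
      "vnorm (M *\<^sub>v v) < sigma_min M + d"
      using sigma_min_approx[of M "sigma_min M + d"] d n M by auto
    then have "v = mat_inv M *\<^sub>v (M *\<^sub>v v)"
      using I M by (simp flip: assoc_mult_mat_vec)
    then have "1 \<le> spec_norm (mat_inv M) * vnorm (M *\<^sub>v v)"
      using v(2) vnorm_mult_le_spec_norm[of "M *\<^sub>v v" "mat_inv M"] I M by (simp add: carrier_vecI)
    also have "\<dots> \<le> spec_norm (mat_inv M) * (sigma_min M + d)"
      using v(3) P by (intro mult_left_mono) auto
    also have "\<dots> \<le> spec_norm (mat_inv M) * sigma_min M + e"
      using d by (simp add: algebra_simps)
    finally show "1 \<le> spec_norm (mat_inv M) * sigma_min M + e" .
  qed
  then show s: "0 < sigma_min M"
    using sigma_min_nonneg[of M] M n by (cases "sigma_min M = 0") auto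
  then show "cond M = ereal (spec_norm M / sigma_min M)" by (simp add: cond_def)
  show "1 \<le> spec_norm M / sigma_min M"
    using s M n sigma_min_le_spec_norm[of M] by simp
  have "spec_norm (mat_inv M) \<le> 1 / sigma_min M"
  proof (rule spec_norm_le)
    fix w assume w: "w \<in> carrier_vec (dim_col (mat_inv M))" "vnorm w = 1"
    then have "w = M *\<^sub>v (mat_inv M *\<^sub>v w)"
      using I M by (simp flip: assoc_mult_mat_vec)
    then have "sigma_min M * vnorm (mat_inv M *\<^sub>v w) \<le> 1"
      using w(2) sigma_min_mult_le[of "mat_inv M *\<^sub>v w" M] I M by (simp add: carrier_vecI)
    then show "vnorm (mat_inv M *\<^sub>v w) \<le> 1 / sigma_min M"
      using s by (simp add: field_simps)
  qed (use I n in auto)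
  then have "spec_norm M * spec_norm (mat_inv M) \<le> spec_norm M * (1 / sigma_min M)"
    using spec_norm_nonneg[of M] M n by (intro mult_left_mono) auto
  then show "spec_norm M * spec_norm (mat_inv M) \<le> spec_norm M / sigma_min M" by simp
qed

section \<open>Leading columns and the augmented matrix\<close>

lemma first_cols_carrier:
  assumes "X \<in> carrier_mat n m" "k \<le> m"
  shows "first_cols k X \<in> carrier_mat n k"
  using assms by (auto simp: first_cols_def intro: carrier_matI)

lemma col_first_cols:
  assumes "X \<in> carrier_mat n m" "k \<le> m" "j < k"
  shows "col (first_cols k X) j = col X j"
proof -
  have "take k (cols X) ! j \<in> carrier_vec (dim_row X)" "take k (cols X) ! j = col X j"
    using assms by auto
  then show ?thesis
    using assms by (simp add: first_cols_def)
qed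

lemma augment_carrier:
  assumes "v \<in> carrier_vec n" "X \<in> carrier_mat n k"
  shows "augment v X \<in> carrier_mat n (Suc k)"
  using assms by (auto simp: augment_def intro: carrier_matI)

lemma col_augment:
  assumes "v \<in> carrier_vec n" "X \<in> carrier_mat n k"
  shows "col (augment v X) 0 = v"
    and "j < k \<Longrightarrow> col (augment v X) (Suc j) = col X j"
  using assms by (simp_all add: augment_def cols_def)

lemma augment_mult_vCons:
  assumes "v \<in> carrier_vec n" "X \<in> carrier_mat n k" "w \<in> carrier_vec k"
  shows "augment v X *\<^sub>v vCons a w = a \<cdot>\<^sub>v v + X *\<^sub>v w"
proof (rule eq_vecI)
  fix i assume "i < dim_vec (a \<cdot>\<^sub>v v + X *\<^sub>v w)"
  then have i: "i < n" using assms by auto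
  have "row (augment v X) i = vCons (v $ i) (row X i)"
    using assms i
    by (intro eq_vecI)
      (auto simp: augment_def vec_index_vCons mat_of_cols_index cols_def row_def nth_Cons
        split: nat.splits)
  then show "(augment v X *\<^sub>v vCons a w) $ i = (a \<cdot>\<^sub>v v + X *\<^sub>v w) $ i"
    using assms i augment_carrier[OF assms(1,2)] by simp
qed (use assms augment_carrier[OF assms(1,2)] in auto)

lemma vec_Suc_cases:
  assumes "x \<in> carrier_vec (Suc k)"
  obtains a w where "w \<in> carrier_vec k" "x = vCons a w"
  using assms by (cases x) auto

section \<open>Least squares residuals and near null vectors\<close>

text \<open>For \<open>t \<noteq> 0\<close> the right-hand side is \<open>\<bar>t\<bar>\<close> times the residual at the competitor \<open>y - z / t\<close>.  In this
  form, optimality stands in for the orthogonality of the residual to the range of \<open>C\<close>.\<close>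

lemma least_squares_residual_le:
  assumes C: "C \<in> carrier_mat s k" and g: "g \<in> carrier_vec s"
    and y: "is_arg_min (\<lambda>y. vnorm (g - C *\<^sub>v y)) (\<lambda>y. y \<in> carrier_vec k) y"
    and z: "z \<in> carrier_vec k"
  shows "\<bar>t\<bar> * vnorm (g - C *\<^sub>v y) \<le> vnorm (t \<cdot>\<^sub>v (g - C *\<^sub>v y) + C *\<^sub>v z)"
proof (cases "t = 0")
  case False
  have yc: "y \<in> carrier_vec k" using y by (simp add: is_arg_min_def)
  define y' where "y' = y - (1 / t) \<cdot>\<^sub>v z"
  have y'c: "y' \<in> carrier_vec k" using yc z by (simp add: y'_def)
  then have "vnorm (g - C *\<^sub>v y) \<le> vnorm (g - C *\<^sub>v y')"
    using y by (auto simp: is_arg_min_def not_less)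
  then have "\<bar>t\<bar> * vnorm (g - C *\<^sub>v y) \<le> vnorm (t \<cdot>\<^sub>v (g - C *\<^sub>v y'))"
    by (simp add: vnorm_smult mult_left_mono)
  also have "C *\<^sub>v y' = C *\<^sub>v y - (1 / t) \<cdot>\<^sub>v (C *\<^sub>v z)"
    unfolding y'_def using C yc z
    by (simp add: mult_minus_distrib_mat_vec[OF C] mult_mat_vec[OF C])
  also have "t \<cdot>\<^sub>v (g - (C *\<^sub>v y - (1 / t) \<cdot>\<^sub>v (C *\<^sub>v z))) = t \<cdot>\<^sub>v (g - C *\<^sub>v y) + C *\<^sub>v z"
    using C g False by (intro eq_vecI) (simp_all add: field_simps)
  finally show ?thesis .
qed simp

text \<open>The exact solution \<open>y\<close> yields the null vector \<open>(1/\<phi>, - y)\<close> of \<open>[\<phi> g, C]\<close> up to the residual.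
  A near null vector \<open>(a, w)\<close> must be almost parallel to it as long as \<open>C\<close> is well conditioned,
  and this keeps \<open>a\<close> away from zero once \<open>\<phi> \<parallel>y\<parallel> \<le> 1\<close>.\<close>

lemma residual_le_of_near_null_vector:
  assumes C: "C \<in> carrier_mat s k" and g: "g \<in> carrier_vec s"
    and y: "is_arg_min (\<lambda>y. vnorm (g - C *\<^sub>v y)) (\<lambda>y. y \<in> carrier_vec k) y"
    and w: "w \<in> carrier_vec k" and unit: "1 \<le> \<bar>a\<bar> + vnorm w"
    and lower: "\<And>z. z \<in> carrier_vec k \<Longrightarrow> \<sigma> * vnorm z \<le> vnorm (C *\<^sub>v z)" and \<sigma>: "0 < \<sigma>"
    and near_null: "vnorm ((a * \<phi>) \<cdot>\<^sub>v g + C *\<^sub>v w) \<le> \<tau>" and \<tau>: "8 * \<tau> \<le> \<sigma>"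
    and \<phi>: "0 < \<phi>" "\<phi> * vnorm y \<le> 1"
  shows "\<phi> * vnorm (g - C *\<^sub>v y) \<le> 4 * \<tau>"
proof -
  define r where "r = g - C *\<^sub>v y"
  define z where "z = (a * \<phi>) \<cdot>\<^sub>v y + w"
  have yc: "y \<in> carrier_vec k" using y by (simp add: is_arg_min_def)
  have zc: "z \<in> carrier_vec k" and rc: "r \<in> carrier_vec s"
    using yc w C g by (simp_all add: z_def r_def)
  have Cz: "C *\<^sub>v z = (a * \<phi>) \<cdot>\<^sub>v (C *\<^sub>v y) + C *\<^sub>v w"
    unfolding z_def using yc w by (simp add: mult_add_distrib_mat_vec[OF C] mult_mat_vec[OF C])
  have split: "(a * \<phi>) \<cdot>\<^sub>v r + C *\<^sub>v z = (a * \<phi>) \<cdot>\<^sub>v g + C *\<^sub>v w"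
    unfolding Cz r_def using C g by (intro eq_vecI) (simp_all add: algebra_simps)
  then have res: "\<bar>a * \<phi>\<bar> * vnorm r \<le> \<tau>"
    using least_squares_residual_le[OF C g y zc, of "a * \<phi>"] near_null by (simp add: r_def)
  have "C *\<^sub>v z = ((a * \<phi>) \<cdot>\<^sub>v g + C *\<^sub>v w) - (a * \<phi>) \<cdot>\<^sub>v r"
    unfolding split[symmetric] using C rc by (intro eq_vecI) simp_all
  then have "vnorm (C *\<^sub>v z) \<le> \<tau> + \<bar>a * \<phi>\<bar> * vnorm r"
    using vnorm_diff_le[of "(a * \<phi>) \<cdot>\<^sub>v g + C *\<^sub>v w" s "(a * \<phi>) \<cdot>\<^sub>v r"] near_null C g rc w
    by (simp add: vnorm_smult)
  with res lower[OF zc] have "\<sigma> * vnorm z \<le> 2 * \<tau>" by linarith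
  with \<tau> have "\<sigma> * vnorm z \<le> \<sigma> * (1 / 4)" by linarith
  with \<sigma> have z: "vnorm z \<le> 1 / 4" using mult_le_cancel_left_pos by blast
  have "w = z - (a * \<phi>) \<cdot>\<^sub>v y"
    unfolding z_def using yc w by (intro eq_vecI) simp_all
  then have "vnorm w \<le> vnorm z + \<bar>a\<bar> * (\<phi> * vnorm y)"
    using vnorm_diff_le[OF zc, of "(a * \<phi>) \<cdot>\<^sub>v y"] yc \<phi> by (simp add: vnorm_smult abs_mult)
  also have "\<dots> \<le> 1 / 4 + \<bar>a\<bar>"
    using z \<phi>(2) mult_left_mono[OF \<phi>(2), of "\<bar>a\<bar>"] by simp
  finally have "1 / 4 \<le> \<bar>a\<bar>" using unit by linarith
  then have "1 / 4 * (\<phi> * vnorm r) \<le> \<bar>a\<bar> * (\<phi> * vnorm r)"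
    using \<phi> by (intro mult_right_mono) auto
  moreover have "\<bar>a\<bar> * (\<phi> * vnorm r) \<le> \<tau>" using res \<phi> by (simp add: abs_mult mult.assoc)
  ultimately show ?thesis unfolding r_def by linarith
qed

section \<open>The sketched least squares problem\<close>

text \<open>The core estimate, with \<open>L\<close> and \<open>\<rho>\<close> the lower and upper distortion of the sketch.  Below, \<open>T\<close> collects
  \<open>\<surd>k \<mu> \<rho> \<parallel>W\<parallel>\<close>, the size of every perturbation of \<open>[\<phi> b, W]\<close> after sketching: the near null vector, the
  error in \<open>g\<close> and the error in \<open>C\<close> contribute \<open>6 T\<close>, \<open>4 T\<close> and \<open>2 T\<close>.  The constant 192 makes
  \<open>8 \<cdot> 12 T\<close> at most half of \<open>L \<sigma>\<^sub>m\<^sub>i\<^sub>n(W)\<close>, as \<open>residual_le_of_near_null_vector\<close> requires.\<close>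

lemma sketched_residual_le:
  assumes S: "S \<in> carrier_mat s n" and W: "W \<in> carrier_mat n k" and b: "b \<in> carrier_vec n"
    and C: "C \<in> carrier_mat s k" and g: "g \<in> carrier_vec s" and k: "1 \<le> k"
    and L: "0 < L" "L \<le> \<rho>"
    and embed: "\<And>a w. w \<in> carrier_vec k \<Longrightarrow>
        L * vnorm (a \<cdot>\<^sub>v b + W *\<^sub>v w) \<le> vnorm (S *\<^sub>v (a \<cdot>\<^sub>v b + W *\<^sub>v w)) \<and>
        vnorm (S *\<^sub>v (a \<cdot>\<^sub>v b + W *\<^sub>v w)) \<le> \<rho> * vnorm (a \<cdot>\<^sub>v b + W *\<^sub>v w)"
    and dg: "vnorm (g - S *\<^sub>v b) \<le> \<eta> * vnorm (S *\<^sub>v b)"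
    and dC: "\<And>j. j < k \<Longrightarrow> vnorm (col C j - S *\<^sub>v col W j) \<le> \<eta> * vnorm (S *\<^sub>v col W j)"
    and y: "is_arg_min (\<lambda>y. vnorm (g - C *\<^sub>v y)) (\<lambda>y. y \<in> carrier_vec k) y"
    and \<eta>: "0 \<le> \<eta>" "\<eta> \<le> 2 * \<mu>"
    and near_singular: "\<And>\<phi>. 0 < \<phi> \<Longrightarrow> \<exists>a w. w \<in> carrier_vec k \<and> vnorm (vCons a w) = 1 \<and>
        vnorm ((a * \<phi>) \<cdot>\<^sub>v b + W *\<^sub>v w) \<le> 2 * \<mu> * (L / \<rho>) * (\<phi> * vnorm b + spec_norm W)"
    and well_cond: "0 < sigma_min W"
      "192 * (sqrt (real k) * \<mu> * (\<rho> * spec_norm W)) \<le> L * sigma_min W"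
  shows "L * vnorm (b - W *\<^sub>v y)
    \<le> 194 * (sqrt (real k) * \<mu>) * (\<rho> * spec_norm W) * vnorm y + \<eta> * \<rho> * vnorm b"
proof -
  define K where "K = sqrt (real k)"
  define Q where "Q = \<rho> * spec_norm W"
  define T where "T = K * \<mu> * Q"
  define E where "E = C - S * W"
  define f where "f = g - S *\<^sub>v b"
  define r where "r = g - C *\<^sub>v y"
  have K: "1 \<le> K" using k by (simp add: K_def)
  have \<mu>: "0 \<le> \<mu>" using \<eta> by linarith
  have \<rho>: "0 < \<rho>" using L by linarith
  have N: "sigma_min W \<le> spec_norm W" using W k by (intro sigma_min_le_spec_norm) auto
  have Q: "0 < Q" using N well_cond(1) \<rho> by (simp add: Q_def)
  have LN: "L * sigma_min W \<le> Q"
    unfolding Q_def using L N well_cond(1) by (intro mult_mono) auto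
  have T: "192 * T \<le> L * sigma_min W" using well_cond(2) by (simp add: T_def K_def Q_def)
  have T0: "0 \<le> T" using K \<mu> Q by (simp add: T_def)
  have M: "192 * (K * \<mu>) \<le> 1"
  proof -
    have "192 * (K * \<mu>) * Q \<le> 1 * Q" using T LN by (simp add: T_def)
    then show ?thesis using Q by (simp only: mult_le_cancel_right_pos)
  qed
  have \<mu>K: "\<mu> \<le> K * \<mu>" using K \<mu> by (simp add: mult_le_cancel_right1)
  have \<mu>Q: "\<mu> * Q \<le> T" unfolding T_def using \<mu>K Q by (intro mult_right_mono) auto
  have \<eta>Q: "\<eta> * (K * Q) \<le> 2 * T"
  proof -
    have "\<eta> * (K * Q) \<le> (2 * \<mu>) * (K * Q)" using \<eta> K Q by (intro mult_right_mono) auto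
    then show ?thesis by (simp add: T_def mult_ac)
  qed

  have yc: "y \<in> carrier_vec k" using y by (simp add: is_arg_min_def)
  have Ec: "E \<in> carrier_mat s k" and fc: "f \<in> carrier_vec s" and rc: "r \<in> carrier_vec s"
    and Sb: "S *\<^sub>v b \<in> carrier_vec s"
    using S W C g b yc by (auto simp: E_def f_def r_def)
  have embed_b: "L * vnorm b \<le> vnorm (S *\<^sub>v b)" "vnorm (S *\<^sub>v b) \<le> \<rho> * vnorm b"
  proof -
    have "1 \<cdot>\<^sub>v b + W *\<^sub>v 0\<^sub>v k = b" using W b by (intro eq_vecI) auto
    then show "L * vnorm b \<le> vnorm (S *\<^sub>v b)" "vnorm (S *\<^sub>v b) \<le> \<rho> * vnorm b"
      using embed[of "0\<^sub>v k" 1] by auto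
  qed
  have embed_W: "L * vnorm (W *\<^sub>v w) \<le> vnorm (S *\<^sub>v (W *\<^sub>v w))"
    "vnorm (S *\<^sub>v (W *\<^sub>v w)) \<le> \<rho> * vnorm (W *\<^sub>v w)" if w: "w \<in> carrier_vec k" for w
  proof -
    have "0 \<cdot>\<^sub>v b + W *\<^sub>v w = W *\<^sub>v w" using W b w by (intro eq_vecI) auto
    then show "L * vnorm (W *\<^sub>v w) \<le> vnorm (S *\<^sub>v (W *\<^sub>v w))"
      "vnorm (S *\<^sub>v (W *\<^sub>v w)) \<le> \<rho> * vnorm (W *\<^sub>v w)"
      using embed[OF w, of 0] by auto
  qed
  have Cw: "C *\<^sub>v w = S *\<^sub>v (W *\<^sub>v w) + E *\<^sub>v w" if w: "w \<in> carrier_vec k" for w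
  proof -
    have "E *\<^sub>v w = C *\<^sub>v w - (S * W) *\<^sub>v w"
      unfolding E_def by (rule minus_mult_distrib_mat_vec[OF C mult_carrier_mat[OF S W] w])
    then have "E *\<^sub>v w = C *\<^sub>v w - S *\<^sub>v (W *\<^sub>v w)"
      by (simp add: assoc_mult_mat_vec[OF S W w])
    then show ?thesis using C S by (intro eq_vecI) auto
  qed

  have "frob_norm E \<le> (\<eta> * \<rho>) * frob_norm W"
  proof (rule frob_norm_le_columnwise)
    fix j assume j: "j < dim_col W"
    have col_SW: "col (S * W) j = S *\<^sub>v col W j" using j by (intro eq_vecI) (use S W in auto)
    have "col E j = col C j - S *\<^sub>v col W j"
      unfolding col_SW[symmetric] E_def using j S W C by (intro eq_vecI) auto
    then have "vnorm (col E j) \<le> \<eta> * vnorm (S *\<^sub>v col W j)" using dC j W by simp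
    also have "vnorm (S *\<^sub>v col W j) \<le> \<rho> * vnorm (col W j)"
      using embed_W(2)[of "unit_vec k j"] mult_unit_vec[OF j] W by simp
    finally show "vnorm (col E j) \<le> \<eta> * \<rho> * vnorm (col W j)"
      using \<eta> by (simp add: mult.assoc mult_left_mono)
  qed (use Ec W \<eta> \<rho> in auto)
  also have "\<dots> \<le> (\<eta> * \<rho>) * (K * spec_norm W)"
    using frob_norm_le_spec_norm[of W] W k \<eta> \<rho> by (intro mult_left_mono) (auto simp: K_def)
  also have "\<dots> = \<eta> * (K * Q)" by (simp add: Q_def mult_ac)
  also note \<eta>Q
  finally have frob_E: "frob_norm E \<le> 2 * T" .
  have E: "vnorm (E *\<^sub>v w) \<le> 2 * T * vnorm w" if w: "w \<in> carrier_vec k" for w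
    using vnorm_mult_le_frob_norm[of w E] w Ec mult_right_mono[OF frob_E, of "vnorm w"] by simp

  have upper: "vnorm (C *\<^sub>v w) \<le> 2 * Q * vnorm w" if w: "w \<in> carrier_vec k" for w
  proof -
    have "vnorm (C *\<^sub>v w) \<le> vnorm (S *\<^sub>v (W *\<^sub>v w)) + vnorm (E *\<^sub>v w)"
      unfolding Cw[OF w] using S W Ec w by (intro vnorm_add_le[of _ s]) auto
    also have "vnorm (S *\<^sub>v (W *\<^sub>v w)) \<le> \<rho> * (spec_norm W * vnorm w)"
      by (rule order_trans[OF embed_W(2)[OF w] mult_left_mono])
        (use vnorm_mult_le_spec_norm[of w W] w W \<rho> in auto)
    also have "vnorm (E *\<^sub>v w) \<le> Q * vnorm w"
      using E[OF w] T LN T0 mult_right_mono[of "2 * T" Q "vnorm w"] by simp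
    finally show ?thesis by (simp add: Q_def)
  qed
  have lower: "L * sigma_min W / 2 * vnorm w \<le> vnorm (C *\<^sub>v w)" if w: "w \<in> carrier_vec k" for w
  proof -
    have "S *\<^sub>v (W *\<^sub>v w) = C *\<^sub>v w - E *\<^sub>v w"
      unfolding Cw[OF w] using S Ec by (intro eq_vecI) auto
    then have "vnorm (S *\<^sub>v (W *\<^sub>v w)) \<le> vnorm (C *\<^sub>v w) + vnorm (E *\<^sub>v w)"
      using vnorm_diff_le[of "C *\<^sub>v w" s "E *\<^sub>v w"] C Ec w by simp
    moreover have "L * (sigma_min W * vnorm w) \<le> vnorm (S *\<^sub>v (W *\<^sub>v w))"
      by (rule order_trans[OF mult_left_mono embed_W(1)[OF w]])
        (use sigma_min_mult_le[of w W] w W L in auto)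
    moreover have "2 * T * vnorm w \<le> L * sigma_min W / 2 * vnorm w"
      using T T0 by (intro mult_right_mono) auto
    ultimately show ?thesis using E[OF w] by (simp add: mult.assoc)
  qed

  have g_le: "vnorm g \<le> 2 * Q * vnorm y + vnorm r"
  proof -
    have "vnorm g \<le> vnorm (C *\<^sub>v y) + vnorm r"
      unfolding r_def using C g yc by (intro vnorm_le_add_diff[of _ s]) auto
    with upper[OF yc] show ?thesis by linarith
  qed
  have Sb_le: "vnorm (S *\<^sub>v b) \<le> 2 * vnorm g"
  proof -
    have "vnorm (S *\<^sub>v b) \<le> vnorm g + vnorm f"
      using vnorm_le_add_diff[OF Sb g] vnorm_minus_commute[OF Sb g] by (simp add: f_def)
    moreover have "\<eta> * vnorm (S *\<^sub>v b) \<le> 1 / 2 * vnorm (S *\<^sub>v b)"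
      using \<eta> \<mu>K M by (intro mult_right_mono) auto
    ultimately show ?thesis using dg by (simp add: f_def)
  qed

  have residual: "vnorm r \<le> 192 * T * vnorm y"
  proof (cases "vnorm g = 0")
    case True
    have "r + C *\<^sub>v y = g" unfolding r_def using C g by (intro eq_vecI) auto
    then have "vnorm r \<le> 0"
      using least_squares_residual_le[OF C g y yc, of 1] True by (simp add: r_def)
    then show ?thesis using T0 by (simp add: order_trans)
  next
    case False
    then have g_pos: "0 < vnorm g" by (simp add: less_le)
    \<comment> \<open>up to a factor 2, \<open>1 / h\<close> is the largest \<open>\<phi>\<close> with \<open>\<phi> \<parallel>y\<parallel> \<le> 1\<close> and \<open>\<phi> \<parallel>g\<parallel> \<le> \<rho> \<parallel>W\<parallel>\<close>\<close>
    define h where "h = vnorm y + vnorm g / Q"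
    have h: "0 < h" using g_pos Q by (simp add: h_def add_nonneg_pos)
    define \<phi> where "\<phi> = 1 / h"
    have \<phi>: "0 < \<phi>" using h by (simp add: \<phi>_def)
    have \<phi>y: "\<phi> * vnorm y \<le> 1" using h Q g_pos by (simp add: \<phi>_def h_def)
    have \<phi>g: "\<phi> * vnorm g \<le> Q"
    proof -
      have "vnorm g / Q \<le> h" by (simp add: h_def)
      then have "vnorm g \<le> h * Q" using Q by (simp add: pos_divide_le_eq)
      then show ?thesis using h by (simp add: \<phi>_def pos_divide_le_eq mult.commute)
    qed
    have \<phi>Sb: "\<phi> * vnorm (S *\<^sub>v b) \<le> 2 * Q"
    proof -
      have "\<phi> * vnorm (S *\<^sub>v b) \<le> \<phi> * (2 * vnorm g)"
        using Sb_le \<phi> by (intro mult_left_mono) auto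
      with \<phi>g show ?thesis by linarith
    qed
    obtain a w where w: "w \<in> carrier_vec k" and unit: "vnorm (vCons a w) = 1"
      and null: "vnorm ((a * \<phi>) \<cdot>\<^sub>v b + W *\<^sub>v w)
        \<le> 2 * \<mu> * (L / \<rho>) * (\<phi> * vnorm b + spec_norm W)"
      using near_singular[OF \<phi>] by blast
    note a1 = vnorm_vCons_eq_1D(1)[OF unit] and w1 = vnorm_vCons_eq_1D(2)[OF unit]
      and sum1 = vnorm_vCons_eq_1D(3)[OF unit]
    have "\<rho> * vnorm ((a * \<phi>) \<cdot>\<^sub>v b + W *\<^sub>v w) \<le> 2 * \<mu> * (\<phi> * (L * vnorm b) + L * spec_norm W)"
    proof -
      have "\<rho> * vnorm ((a * \<phi>) \<cdot>\<^sub>v b + W *\<^sub>v w)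
        \<le> \<rho> * (2 * \<mu> * (L / \<rho>) * (\<phi> * vnorm b + spec_norm W))"
        using null \<rho> by (intro mult_left_mono) auto
      also have "\<dots> = 2 * \<mu> * (\<phi> * (L * vnorm b) + L * spec_norm W)"
        using \<rho> by (simp add: distrib_left)
      finally show ?thesis .
    qed
    also have "\<dots> \<le> 2 * \<mu> * (2 * Q + Q)"
    proof (intro mult_left_mono add_mono)
      show "\<phi> * (L * vnorm b) \<le> 2 * Q"
        by (rule order_trans[OF mult_left_mono[OF embed_b(1)] \<phi>Sb]) (use \<phi> in simp)
      show "L * spec_norm W \<le> Q"
        unfolding Q_def using L N well_cond(1) by (intro mult_right_mono) auto
    qed (use \<mu> in auto)
    also have "\<dots> \<le> 6 * T" using \<mu>Q by simp
    finally have t1: "vnorm (S *\<^sub>v ((a * \<phi>) \<cdot>\<^sub>v b + W *\<^sub>v w)) \<le> 6 * T"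
      using embed[OF w, of "a * \<phi>"] by linarith
    have t2: "vnorm ((a * \<phi>) \<cdot>\<^sub>v f) \<le> 4 * T"
    proof -
      have "vnorm ((a * \<phi>) \<cdot>\<^sub>v f) = \<bar>a\<bar> * (\<phi> * vnorm f)"
        using \<phi> by (simp add: vnorm_smult abs_mult)
      also have "\<dots> \<le> 1 * (\<phi> * (\<eta> * vnorm (S *\<^sub>v b)))"
        using a1 \<phi> dg by (intro mult_mono) (auto simp: f_def)
      also have "\<dots> = \<eta> * (\<phi> * vnorm (S *\<^sub>v b))" by simp
      also have "\<dots> \<le> (2 * \<mu>) * (2 * Q)"
        by (rule mult_mono[OF \<eta>(2) \<phi>Sb]) (use \<phi> \<mu> in auto)
      finally show ?thesis using \<mu>Q by simp
    qed
    have t3: "vnorm (E *\<^sub>v w) \<le> 2 * T"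
      using E[OF w] mult_left_mono[OF w1, of "2 * T"] T0 by simp
    have "(a * \<phi>) \<cdot>\<^sub>v g + C *\<^sub>v w
      = (S *\<^sub>v ((a * \<phi>) \<cdot>\<^sub>v b + W *\<^sub>v w) + (a * \<phi>) \<cdot>\<^sub>v f) + E *\<^sub>v w"
    proof -
      have "S *\<^sub>v ((a * \<phi>) \<cdot>\<^sub>v b + W *\<^sub>v w) = (a * \<phi>) \<cdot>\<^sub>v (S *\<^sub>v b) + S *\<^sub>v (W *\<^sub>v w)"
        using b W w by (simp add: mult_add_distrib_mat_vec[OF S] mult_mat_vec[OF S])
      then show ?thesis
        unfolding Cw[OF w] f_def using S Ec g by (intro eq_vecI) (simp_all add: algebra_simps)
    qed
    then have "vnorm ((a * \<phi>) \<cdot>\<^sub>v g + C *\<^sub>v w) \<le> 6 * T + 4 * T + 2 * T"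
      using t1 t2 t3 vnorm_add_le[of "S *\<^sub>v ((a * \<phi>) \<cdot>\<^sub>v b + W *\<^sub>v w)" s "(a * \<phi>) \<cdot>\<^sub>v f"]
        vnorm_add_le[of "S *\<^sub>v ((a * \<phi>) \<cdot>\<^sub>v b + W *\<^sub>v w) + (a * \<phi>) \<cdot>\<^sub>v f" s "E *\<^sub>v w"] S W b w Ec fc
      by simp
    then have "\<phi> * vnorm r \<le> 4 * (12 * T)"
      unfolding r_def using T L well_cond(1) \<phi> \<phi>y
      by (intro residual_le_of_near_null_vector[OF C g y w sum1 lower]) auto
    then have "vnorm r \<le> 48 * T * h"
      using h by (simp add: \<phi>_def pos_divide_le_eq)
    also have "\<dots> = 48 * (K * \<mu>) * (Q * vnorm y + vnorm g)"
      using Q by (simp add: T_def h_def field_simps)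
    \<comment> \<open>the residual reappears on the right, with a coefficient that is at most 1/4\<close>
    also have "\<dots> \<le> 48 * (K * \<mu>) * (Q * vnorm y + (2 * Q * vnorm y + vnorm r))"
      using g_le K \<mu> by (intro mult_left_mono) auto
    also have "\<dots> = 144 * T * vnorm y + 48 * (K * \<mu>) * vnorm r"
      by (simp add: T_def algebra_simps)
    also have "48 * (K * \<mu>) * vnorm r \<le> 1 / 4 * vnorm r"
      using M by (intro mult_right_mono) auto
    finally show ?thesis by simp
  qed

  have "S *\<^sub>v (b - W *\<^sub>v y) = (r - f) + E *\<^sub>v y"
  proof -
    have "S *\<^sub>v (b - W *\<^sub>v y) = S *\<^sub>v b - S *\<^sub>v (W *\<^sub>v y)"
      using b W yc by (simp add: mult_minus_distrib_mat_vec[OF S])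
    then show ?thesis
      unfolding r_def f_def Cw[OF yc] using S Ec g by (intro eq_vecI) simp_all
  qed
  then have "vnorm (S *\<^sub>v (b - W *\<^sub>v y)) \<le> vnorm r + vnorm f + vnorm (E *\<^sub>v y)"
    using vnorm_add_le[of "r - f" s "E *\<^sub>v y"] vnorm_diff_le[OF rc fc] rc fc Ec yc by simp
  also have "vnorm f \<le> \<eta> * (\<rho> * vnorm b)"
    using dg mult_left_mono[OF embed_b(2) \<eta>(1)] by (simp add: f_def)
  finally have "vnorm (S *\<^sub>v (b - W *\<^sub>v y)) \<le> 194 * T * vnorm y + \<eta> * \<rho> * vnorm b"
    using residual E[OF yc] by simp
  moreover have "L * vnorm (b - W *\<^sub>v y) \<le> vnorm (S *\<^sub>v (b - W *\<^sub>v y))"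
  proof -
    have "1 \<cdot>\<^sub>v b + W *\<^sub>v (- y) = b - W *\<^sub>v y"
      using W b yc by (intro eq_vecI) (auto simp: uminus_mult_mat_vec)
    then show ?thesis using embed[of "- y" 1] yc by simp
  qed
  ultimately show ?thesis by (simp add: T_def K_def Q_def mult.assoc)
qed

section \<open>Reading off the hypotheses of the critical iteration\<close>

text \<open>In the extended reals \<open>0 * \<infinity> = 0\<close>, so the hypothesis fails for \<open>c = 0\<close> even if \<open>X\<close> is singular.  Hence
  \<open>c > 0\<close>, and \<open>2 c B\<close> lies strictly above the smallest singular value, as \<open>sigma_min_approx\<close> requires.\<close>

lemma near_null_vector_of_cond:
  assumes X: "0 < dim_col X" and c: "0 \<le> c" "1 \<le> ereal c * cond X"
    and B: "spec_norm X \<le> B" "0 < B"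
  obtains v where "v \<in> carrier_vec (dim_col X)" "vnorm v = 1" "vnorm (X *\<^sub>v v) \<le> 2 * c * B"
proof -
  have c_pos: "0 < c" using c by (cases "c = 0") (auto simp flip: zero_ereal_def)
  have "sigma_min X < 2 * c * B"
  proof (cases "sigma_min X = 0")
    case False
    then have s: "0 < sigma_min X" using sigma_min_nonneg[OF X] by simp
    with c(2) have "sigma_min X \<le> c * spec_norm X" by (simp add: cond_def field_simps one_ereal_def)
    also have "\<dots> \<le> c * B" using B c by (intro mult_left_mono) auto
    also have "\<dots> < 2 * c * B" using c_pos B by simp
    finally show ?thesis .
  qed (use c_pos B in simp)
  then show ?thesis using sigma_min_approx[OF X] that by (metis less_imp_le)
qed

lemma augment_smult_mult_vCons:
  assumes "b \<in> carrier_vec n" "W \<in> carrier_mat n k" "w \<in> carrier_vec k"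
  shows "augment (\<phi> \<cdot>\<^sub>v b) W *\<^sub>v vCons a w = (a * \<phi>) \<cdot>\<^sub>v b + W *\<^sub>v w"
  using augment_mult_vCons[of "\<phi> \<cdot>\<^sub>v b" n W k w a] assms by (simp add: smult_smult_assoc)

lemma spec_norm_augment_le:
  assumes b: "b \<in> carrier_vec n" and W: "W \<in> carrier_mat n k" and k: "1 \<le> k" and \<phi>: "0 \<le> \<phi>"
  shows "spec_norm (augment (\<phi> \<cdot>\<^sub>v b) W) \<le> \<phi> * vnorm b + spec_norm W"
proof (rule spec_norm_le)
  have X: "augment (\<phi> \<cdot>\<^sub>v b) W \<in> carrier_mat n (Suc k)" using b W by (simp add: augment_carrier)
  then show "0 < dim_col (augment (\<phi> \<cdot>\<^sub>v b) W)" by simp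
  fix v assume v: "v \<in> carrier_vec (dim_col (augment (\<phi> \<cdot>\<^sub>v b) W))" "vnorm v = 1"
  have "v \<in> carrier_vec (Suc k)" using v(1) X by simp
  then obtain a w where w: "w \<in> carrier_vec k" and v_def: "v = vCons a w"
    by (blast elim: vec_Suc_cases)
  note unit = vnorm_vCons_eq_1D[OF v(2)[unfolded v_def]]
  have "vnorm (augment (\<phi> \<cdot>\<^sub>v b) W *\<^sub>v v) \<le> vnorm ((a * \<phi>) \<cdot>\<^sub>v b) + vnorm (W *\<^sub>v w)"
    unfolding v_def augment_smult_mult_vCons[OF b W w]
    using b W w by (intro vnorm_add_le[of _ n]) auto
  also have "vnorm ((a * \<phi>) \<cdot>\<^sub>v b) \<le> \<phi> * vnorm b"
    using mult_right_mono[OF unit(1), of "\<phi> * vnorm b"] \<phi> by (simp add: vnorm_smult abs_mult mult.assoc)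
  also have "vnorm (W *\<^sub>v w) \<le> spec_norm W"
    using vnorm_mult_le_spec_norm[of w W] w W mult_left_mono[OF unit(2) spec_norm_nonneg[of W]] k by simp
  finally show "vnorm (augment (\<phi> \<cdot>\<^sub>v b) W *\<^sub>v v) \<le> \<phi> * vnorm b + spec_norm W" by simp
qed

text \<open>Rounding in the sketch followed by the backward error of the least squares solver; the
  result is the factor \<open>\<epsilon>\<^sub>s\<^sub>l\<^sub>s + (1 + \<epsilon>\<^sub>s\<^sub>l\<^sub>s) \<epsilon>\<^sub>S\<close> in the theorem's term in \<open>\<parallel>b\<parallel>\<close>.\<close>

lemma relative_perturbation_compose:
  assumes "x \<in> carrier_vec n" "y \<in> carrier_vec n" "d \<in> carrier_vec n" "0 \<le> c"
    and xy: "vnorm (y - x) \<le> a * vnorm x" and d: "vnorm d \<le> c * vnorm y"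
  shows "vnorm (y + d - x) \<le> (c + (1 + c) * a) * vnorm x"
proof -
  have "vnorm y \<le> (1 + a) * vnorm x"
    using vnorm_le_add_diff[of y n x] assms by (simp add: algebra_simps)
  with \<open>0 \<le> c\<close> have "c * vnorm y \<le> c * ((1 + a) * vnorm x)" by (rule mult_left_mono[rotated])
  moreover have "vnorm (y + d - x) \<le> vnorm (y - x) + vnorm d"
  proof -
    have "y + d - x = (y - x) + d" using assms by (intro eq_vecI) auto
    then show ?thesis using vnorm_add_le[of "y - x" n d] assms by simp
  qed
  ultimately show ?thesis using xy d by (simp add: algebra_simps)
qed

text \<open>The residual of the unsketched preconditioned problem.  The second claim serves to absorb the
  product \<open>\<surd>k \<mu> \<beta> \<epsilon>\<^sub>W\<close> that arises when \<open>\<parallel>W\<parallel>\<close> is traced back to \<open>\<parallel>Z\<parallel>\<close>, with \<open>\<epsilon>\<^sub>W\<close> possibly large.\<close>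

lemma critical_preconditioned_residual_le:
  fixes r :: sgmres_run and e :: rounding_params and \<epsilon> :: real and k :: nat
  defines "\<eta> \<equiv> esls e + (1 + esls e) * eS e" and "\<mu> \<equiv> eS e + esls e"
    and "\<beta> \<equiv> sqrt ((1 + \<epsilon>) / (1 - \<epsilon>))" and "W \<equiv> first_cols k (Wh r)"
  assumes dims: "run_dims n s m r" "S \<in> carrier_mat s n" and k: "1 \<le> k" "k \<le> m"
    and \<epsilon>: "0 < \<epsilon>" "\<epsilon> < 1" and nonneg: "0 \<le> eS e" "0 \<le> esls e"
    and C: "\<And>j. j < m \<Longrightarrow> rounding_C S (eS e) r j" and g: "rounding_g S (eS e) r"
    and LS: "rounding_LS (esls e) r k"
    and crit: "critical_iteration 1 96 \<epsilon> e r k" and sketch: "sketch_event n \<epsilon> S r k"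
  shows "vnorm (bh r - W *\<^sub>v yh r k)
      \<le> 194 * (sqrt (real k) * \<mu> * \<beta>) * spec_norm W * vnorm (yh r k) + \<eta> * \<beta> * vnorm (bh r)"
    and "sqrt (real k) * \<mu> * \<beta> \<le> 1 / 192"
proof -
  define L where "L = sqrt (1 - \<epsilon>)"
  define \<rho> where "\<rho> = sqrt (1 + \<epsilon>)"
  have L: "0 < L" "L \<le> \<rho>" and \<rho>: "0 < \<rho>" using \<epsilon> by (simp_all add: L_def \<rho>_def)
  have \<beta>_eq: "\<beta> = \<rho> / L" by (simp add: \<beta>_def \<rho>_def L_def real_sqrt_divide)
  have \<beta>: "1 \<le> \<beta>" using L by (simp add: \<beta>_eq)
  have K: "1 \<le> sqrt (real k)" using k by simp

  have W: "W \<in> carrier_mat n k" and b: "bh r \<in> carrier_vec n" and gh: "gh r \<in> carrier_vec s"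
    and Ch: "Ch r \<in> carrier_mat s m" "first_cols k (Ch r) \<in> carrier_mat s k"
    and Wh: "Wh r \<in> carrier_mat n m" and y: "yh r k \<in> carrier_vec k"
    using dims k by (auto simp: run_dims_def W_def first_cols_carrier)

  have crit1: "1 \<le> ereal (\<mu> * (L / \<rho>)) * cond (augment (\<phi> \<cdot>\<^sub>v bh r) W)" if "0 < \<phi>" for \<phi>
    using crit that by (simp add: critical_iteration_def \<mu>_def L_def \<rho>_def W_def real_sqrt_divide)
  \<comment> \<open>the first criticality condition fails for an error-free sketch and solver, as \<open>0 * \<infinity> = 0\<close>\<close>
  have "\<mu> \<noteq> 0" using crit1[of 1] by (auto simp flip: zero_ereal_def)
  then have \<mu>: "0 < \<mu>" using nonneg by (simp add: \<mu>_def)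

  have crit2: "ereal (sqrt (real k) * 96 * \<mu> * \<beta>) * cond W \<le> ereal (1 / 2)"
    using crit by (simp add: critical_iteration_def \<mu>_def \<beta>_def W_def)
  \<comment> \<open>as \<open>\<mu> > 0\<close>, an infinite condition number would make the left-hand side infinite\<close>
  have "cond W \<noteq> \<infinity>" using crit2 \<mu> \<beta> k by auto
  note cW = cond_finiteD[OF this]
  have \<sigma>: "0 < sigma_min W" and N: "sigma_min W \<le> spec_norm W"
    using cW(1) sigma_min_le_spec_norm[of W] W k by auto
  have well: "192 * (sqrt (real k) * \<mu> * \<beta>) * spec_norm W \<le> sigma_min W"
    using crit2 cW(2) \<sigma> W k by (simp add: field_simps)
  show small: "sqrt (real k) * \<mu> * \<beta> \<le> 1 / 192"
  proof -
    have "192 * (sqrt (real k) * \<mu> * \<beta>) * spec_norm W \<le> 1 * spec_norm W" using well N by linarith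
    then show ?thesis using \<sigma> N by (simp only: mult_le_cancel_right) linarith
  qed
  have "\<mu> \<le> sqrt (real k) * \<mu> * \<beta>"
    using mult_mono[OF K \<beta>] \<mu> mult_right_mono[of 1 "sqrt (real k) * \<beta>" \<mu>] by (simp add: mult_ac)
  with small nonneg have "esls e \<le> 1" by (simp add: \<mu>_def)
  then have \<eta>: "0 \<le> \<eta>" "\<eta> \<le> 2 * \<mu>"
    using nonneg mult_right_mono[of "esls e" 1 "eS e"] by (simp_all add: \<eta>_def \<mu>_def algebra_simps)

  have embed: "L * vnorm (a \<cdot>\<^sub>v bh r + W *\<^sub>v w) \<le> vnorm (S *\<^sub>v (a \<cdot>\<^sub>v bh r + W *\<^sub>v w)) \<and>
      vnorm (S *\<^sub>v (a \<cdot>\<^sub>v bh r + W *\<^sub>v w)) \<le> \<rho> * vnorm (a \<cdot>\<^sub>v bh r + W *\<^sub>v w)"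
    if w: "w \<in> carrier_vec k" for a w
  proof -
    let ?v = "a \<cdot>\<^sub>v bh r + W *\<^sub>v w"
    have X: "augment (bh r) W \<in> carrier_mat n (Suc k)" using b W by (simp add: augment_carrier)
    have "?v \<in> vec_space.col_space n (augment (bh r) W)"
      unfolding vec_space.col_space_eq[OF X] using X w b W augment_mult_vCons[OF b W w, of a]
      by (auto intro!: bexI[of _ "vCons a w"])
    then have "(1 - \<epsilon>) * (vnorm ?v)\<^sup>2 \<le> (vnorm (S *\<^sub>v ?v))\<^sup>2"
      "(vnorm (S *\<^sub>v ?v))\<^sup>2 \<le> (1 + \<epsilon>) * (vnorm ?v)\<^sup>2"
      using sketch by (auto simp: sketch_event_def subspace_embedding_def W_def)
    then have "(L * vnorm ?v)\<^sup>2 \<le> (vnorm (S *\<^sub>v ?v))\<^sup>2" "(vnorm (S *\<^sub>v ?v))\<^sup>2 \<le> (\<rho> * vnorm ?v)\<^sup>2"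
      using \<epsilon> by (simp_all add: L_def \<rho>_def power_mult_distrib)
    then show ?thesis using \<rho> power2_le_imp_le[of "L * vnorm ?v"] power2_le_imp_le[of "vnorm (S *\<^sub>v ?v)"] by simp
  qed

  have near_singular: "\<exists>a w. w \<in> carrier_vec k \<and> vnorm (vCons a w) = 1 \<and>
      vnorm ((a * \<phi>) \<cdot>\<^sub>v bh r + W *\<^sub>v w) \<le> 2 * \<mu> * (L / \<rho>) * (\<phi> * vnorm (bh r) + spec_norm W)"
    if \<phi>: "0 < \<phi>" for \<phi>
  proof -
    let ?X = "augment (\<phi> \<cdot>\<^sub>v bh r) W"
    have X: "?X \<in> carrier_mat n (Suc k)" using b W by (simp add: augment_carrier)
    obtain v where v: "v \<in> carrier_vec (dim_col ?X)" "vnorm v = 1"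
      "vnorm (?X *\<^sub>v v) \<le> 2 * (\<mu> * (L / \<rho>)) * (\<phi> * vnorm (bh r) + spec_norm W)"
    proof (rule near_null_vector_of_cond)
      show "1 \<le> ereal (\<mu> * (L / \<rho>)) * cond ?X" by (rule crit1[OF \<phi>])
      show "spec_norm ?X \<le> \<phi> * vnorm (bh r) + spec_norm W"
        using spec_norm_augment_le[OF b W k(1)] \<phi> by simp
    qed (use X \<mu> L \<rho> \<phi> \<sigma> N in \<open>auto simp: add_nonneg_pos\<close>)
    have "v \<in> carrier_vec (Suc k)" using v(1) X by simp
    then obtain a w where "w \<in> carrier_vec k" "v = vCons a w" by (blast elim: vec_Suc_cases)
    then show ?thesis
      using v augment_smult_mult_vCons[OF b W, of w \<phi> a]
      by (intro exI[of _ a] exI[of _ w]) (simp add: mult.assoc)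
  qed

  obtain dg dC where dg: "dg \<in> carrier_vec s" and dC: "dC \<in> carrier_mat s k"
    and cols: "\<And>j. j < k + 1 \<Longrightarrow> vnorm (col (augment dg dC) j)
      \<le> esls e * vnorm (col (augment (gh r) (first_cols k (Ch r))) j)"
    and min: "is_arg_min (\<lambda>y. vnorm ((gh r + dg) - (first_cols k (Ch r) + dC) *\<^sub>v y))
      (\<lambda>y. y \<in> carrier_vec k) (yh r k)"
    using LS gh Ch by (auto simp: rounding_LS_def)
  have Sb: "S *\<^sub>v bh r \<in> carrier_vec s" using dims b by simp
  have dg_le: "vnorm dg \<le> esls e * vnorm (gh r)"
    using cols[of 0] col_augment(1)[OF dg dC] col_augment(1)[OF gh Ch(2)] by simp
  have dC_le: "vnorm (col dC j) \<le> esls e * vnorm (col (Ch r) j)" if "j < k" for j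
    using cols[of "Suc j"] that col_augment(2)[OF dg dC] col_augment(2)[OF gh Ch(2)]
      col_first_cols[OF Ch(1) k(2)] by simp
  have main: "L * vnorm (bh r - W *\<^sub>v yh r k)
      \<le> 194 * (sqrt (real k) * \<mu>) * (\<rho> * spec_norm W) * vnorm (yh r k) + \<eta> * \<rho> * vnorm (bh r)"
  proof (rule sketched_residual_le[OF dims(2) W b _ _ k(1) L embed _ _ min \<eta> near_singular \<sigma>])
    show "vnorm (gh r + dg - S *\<^sub>v bh r) \<le> \<eta> * vnorm (S *\<^sub>v bh r)"
      unfolding \<eta>_def using g dg_le nonneg
      by (intro relative_perturbation_compose[OF Sb gh dg]) (auto simp: rounding_g_def)
    fix j assume j: "j < k"
    have Wj: "col W j = col (Wh r) j" unfolding W_def by (rule col_first_cols[OF Wh k(2) j])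
    have "vnorm (col (Ch r) j + col dC j - S *\<^sub>v col W j) \<le> \<eta> * vnorm (S *\<^sub>v col W j)"
      unfolding \<eta>_def using C[of j] dC_le[OF j] nonneg j k Ch dC dims Wh
      by (intro relative_perturbation_compose[of _ s]) (auto simp: rounding_C_def Wj intro: mult_mat_vec_carrier)
    moreover have "col (first_cols k (Ch r) + dC) j = col (Ch r) j + col dC j"
      unfolding col_first_cols[OF Ch(1) k(2) j, symmetric] using j Ch dC by (intro eq_vecI) auto
    ultimately show "vnorm (col (first_cols k (Ch r) + dC) j - S *\<^sub>v col W j)
        \<le> \<eta> * vnorm (S *\<^sub>v col W j)" by simp
  next
    have "L * (192 * (sqrt (real k) * \<mu> * \<beta>) * spec_norm W) \<le> L * sigma_min W"
      using well L by (intro mult_left_mono) auto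
    then show "192 * (sqrt (real k) * \<mu> * (\<rho> * spec_norm W)) \<le> L * sigma_min W"
      using L by (simp add: \<beta>_eq)
  qed (use gh dg dC Ch in auto)
  have "vnorm (bh r - W *\<^sub>v yh r k)
      \<le> (194 * (sqrt (real k) * \<mu>) * (\<rho> * spec_norm W) * vnorm (yh r k) + \<eta> * \<rho> * vnorm (bh r)) / L"
    using main L by (simp add: pos_le_divide_eq mult.commute)
  then show "vnorm (bh r - W *\<^sub>v yh r k)
      \<le> 194 * (sqrt (real k) * \<mu> * \<beta>) * spec_norm W * vnorm (yh r k) + \<eta> * \<beta> * vnorm (bh r)"
    by (simp add: \<beta>_eq add_divide_distrib mult_ac)
qed

section \<open>From the sketched residual to the true residual\<close>

text \<open>As \<open>x\<close> is close to \<open>Z y\<close>, its norm is at least \<open>\<sigma>\<^sub>m\<^sub>i\<^sub>n(Z) \<parallel>y\<parallel> / 2\<close>: the error made in forming \<open>x\<close> takes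
  away no more than half.\<close>

lemma spec_norm_times_coordinates_le:
  assumes Z: "Z \<in> carrier_mat n k" and k: "1 \<le> k" and y: "y \<in> carrier_vec k" and x: "x \<in> carrier_vec n"
    and dx: "vnorm (x - Z *\<^sub>v y) \<le> \<delta> * spec_norm Z * vnorm y"
    and finite: "0 < sigma_min Z" and small: "\<delta> * (spec_norm Z / sigma_min Z) \<le> 1 / 2"
  shows "spec_norm Z * vnorm y \<le> 2 * (spec_norm Z / sigma_min Z) * vnorm x"
proof -
  have "\<delta> * spec_norm Z \<le> sigma_min Z / 2" using small finite by (simp add: field_simps)
  then have "\<delta> * spec_norm Z * vnorm y \<le> sigma_min Z / 2 * vnorm y" by (rule mult_right_mono) simp
  moreover have "sigma_min Z * vnorm y \<le> vnorm x + vnorm (x - Z *\<^sub>v y)"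
    using sigma_min_mult_le[of y Z] vnorm_le_add_diff[of "Z *\<^sub>v y" n x]
      vnorm_minus_commute[of "Z *\<^sub>v y" n x] Z y x by simp
  ultimately have "sigma_min Z * vnorm y \<le> 2 * vnorm x" using dx by simp
  then have "vnorm y \<le> 2 * vnorm x / sigma_min Z" using finite by (simp add: field_simps)
  then have "spec_norm Z * vnorm y \<le> spec_norm Z * (2 * vnorm x / sigma_min Z)"
    using spec_norm_nonneg[of Z] Z k by (intro mult_left_mono) auto
  then show ?thesis by (simp add: mult_ac)
qed

text \<open>The computed quantities satisfy
  \<open>M\<^sup>-\<^sup>1 (b - A Z y) = (c - W y) - (c - M\<^sup>-\<^sup>1 b) + (W - M\<^sup>-\<^sup>1 A Z) y\<close>.\<close>

lemma true_residual_le: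
  assumes A: "A \<in> carrier_mat n n" and M: "M \<in> carrier_mat n n" "invertible_mat M" and n: "1 \<le> n"
    and b: "b \<in> carrier_vec n" and c: "c \<in> carrier_vec n"
    and W: "W \<in> carrier_mat n k" and Z: "Z \<in> carrier_mat n k"
    and y: "y \<in> carrier_vec k" and x: "x \<in> carrier_vec n"
  shows "vnorm (b - A *\<^sub>v x)
    \<le> spec_norm M * (vnorm (c - W *\<^sub>v y) + vnorm (c - mat_inv M *\<^sub>v b)
        + frob_norm (W - mat_inv M * A * Z) * vnorm y)
      + frob_norm A * vnorm (x - Z *\<^sub>v y)"
proof -
  note I = mat_inv_props[OF M]
  have IA: "mat_inv M * A \<in> carrier_mat n n" and IAZ: "mat_inv M * A * Z \<in> carrier_mat n k"
    using I A Z by auto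
  define Zy where "Zy = Z *\<^sub>v y"
  define rb where "rb = c - W *\<^sub>v y"
  define db where "db = c - mat_inv M *\<^sub>v b"
  define dWy where "dWy = (W - mat_inv M * A * Z) *\<^sub>v y"
  have Zy: "Zy \<in> carrier_vec n" and rb: "rb \<in> carrier_vec n" and db: "db \<in> carrier_vec n"
    using Z W y c b I by (auto simp: Zy_def rb_def db_def)
  have dWy: "dWy \<in> carrier_vec n"
    unfolding dWy_def by (rule mult_mat_vec_carrier[OF minus_carrier_mat[OF IAZ] y])
  have dWy_eq: "dWy = W *\<^sub>v y - mat_inv M *\<^sub>v (A *\<^sub>v Zy)"
    unfolding dWy_def Zy_def
    by (simp add: minus_mult_distrib_mat_vec[OF W IAZ y] assoc_mult_mat_vec[OF IA Z y]
        assoc_mult_mat_vec[OF I(1) A] mult_mat_vec_carrier[OF Z y])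
  have "mat_inv M *\<^sub>v (b - A *\<^sub>v Zy) = mat_inv M *\<^sub>v b - mat_inv M *\<^sub>v (A *\<^sub>v Zy)"
    using A b Zy by (intro mult_minus_distrib_mat_vec[OF I(1)]) auto
  also have "\<dots> = (rb - db) + dWy"
    unfolding dWy_eq rb_def db_def using c b W y I A Zy by (intro eq_vecI) auto
  finally have pre: "mat_inv M *\<^sub>v (b - A *\<^sub>v Zy) = (rb - db) + dWy" .
  have "M *\<^sub>v ((rb - db) + dWy) = (M * mat_inv M) *\<^sub>v (b - A *\<^sub>v Zy)"
    unfolding pre[symmetric] using A b Zy by (intro assoc_mult_mat_vec[OF M(1) I(1), symmetric]) auto
  also have "\<dots> = b - A *\<^sub>v Zy" using I A b Zy by simp
  finally have post: "M *\<^sub>v ((rb - db) + dWy) = b - A *\<^sub>v Zy" .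
  have "b - A *\<^sub>v x = M *\<^sub>v ((rb - db) + dWy) - A *\<^sub>v (x - Zy)"
    unfolding post mult_minus_distrib_mat_vec[OF A x Zy] using A b x Zy by (intro eq_vecI) auto
  then have "vnorm (b - A *\<^sub>v x) \<le> vnorm (M *\<^sub>v ((rb - db) + dWy)) + vnorm (A *\<^sub>v (x - Zy))"
    using vnorm_diff_le[of "M *\<^sub>v ((rb - db) + dWy)" n "A *\<^sub>v (x - Zy)"] M A x Zy rb db dWy by simp
  also have "vnorm (M *\<^sub>v ((rb - db) + dWy)) \<le> spec_norm M * vnorm ((rb - db) + dWy)"
    using M rb db dWy by (intro vnorm_mult_le_spec_norm) auto
  also have "\<dots> \<le> spec_norm M * (vnorm rb + vnorm db + frob_norm (W - mat_inv M * A * Z) * vnorm y)"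
  proof (rule mult_left_mono)
    have "vnorm dWy \<le> frob_norm (W - mat_inv M * A * Z) * vnorm y"
      unfolding dWy_def using IAZ Z y by (intro vnorm_mult_le_frob_norm) auto
    then show "vnorm ((rb - db) + dWy)
        \<le> vnorm rb + vnorm db + frob_norm (W - mat_inv M * A * Z) * vnorm y"
      using vnorm_add_le[of "rb - db" n dWy] vnorm_diff_le[OF rb db] rb db dWy by simp
  qed (use M n in \<open>simp add: spec_norm_nonneg\<close>)
  also have "vnorm (A *\<^sub>v (x - Zy)) \<le> frob_norm A * vnorm (x - Zy)"
    using A x Zy by (intro vnorm_mult_le_frob_norm) auto
  finally show ?thesis by (simp add: rb_def db_def Zy_def)
qed

text \<open>The factor \<open>k\<close> arises because \<open>\<surd>k\<close> enters twice: through the columnwise bounds on the perturbation of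
  \<open>S W\<close>, and through \<open>\<parallel>Z\<parallel>\<^sub>F \<le> \<surd>k \<parallel>Z\<parallel>\<close>.  The norm of the computed \<open>W\<close> carries a factor \<open>1 + \<epsilon>\<^sub>W\<close>, whose
  \<open>\<epsilon>\<^sub>W\<close> is multiplied by \<open>\<surd>k \<mu> \<beta> \<le> 1/192\<close> and so only adds to the coefficient of \<open>\<epsilon>\<^sub>W\<close>.\<close>

lemma critical_iteration_error:
  fixes e :: rounding_params and \<epsilon> :: real and M :: "real mat" and r :: sgmres_run
    and k :: nat
  defines "\<eta> \<equiv> esls e + (1 + esls e) * eS e" and "\<mu> \<equiv> eS e + esls e"
    and "\<gamma> \<equiv> (1 + \<epsilon>) / (1 - \<epsilon>)" and "Z \<equiv> first_cols k (Zh r)"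
  defines "\<kappa>L \<equiv> spec_norm M / sigma_min M" and "\<kappa>Z \<equiv> spec_norm Z / sigma_min Z"
  assumes setting: "sgmres_setting n s m A b M MR \<epsilon> D e R" and S: "S \<in> space D" and r: "r = R S"
    and k: "1 \<le> k" "k \<le> m"
    and crit: "critical_iteration 1 96 \<epsilon> e r k" and sketch: "sketch_event n \<epsilon> S r k"
  shows "cond M = ereal \<kappa>L" "cond Z = ereal \<kappa>Z" "1 \<le> \<kappa>L" "1 \<le> \<kappa>Z" "1 \<le> \<gamma>" "\<mu> \<le> 1 / 192"
    and "vnorm (b - A *\<^sub>v xh r k)
      \<le> 400 * real k * (\<gamma> * \<mu> + eW e + ex e) * \<kappa>L * \<kappa>Z * (frob_norm A * vnorm (xh r k))
        + (\<gamma> * (1 + eb e) * \<eta> + eb e) * \<kappa>L * vnorm b"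
proof -
  have n: "1 \<le> n" and A: "A \<in> carrier_mat n n" and b: "b \<in> carrier_vec n"
    and M: "M \<in> carrier_mat n n" "invertible_mat M" and \<epsilon>: "0 < \<epsilon>" "\<epsilon> < 1"
    and nonneg: "0 \<le> eW e" "0 \<le> eb e" "0 \<le> eS e" "0 \<le> esls e" "0 \<le> ex e"
    and dims: "run_dims n s m r" "S \<in> carrier_mat s n" and model: "rounding_model m A b M S e r"
    using setting S by (auto simp: sgmres_setting_def r)
  define W where "W = first_cols k (Wh r)"
  define \<beta> where "\<beta> = sqrt \<gamma>"
  define K where "K = sqrt (real k)"
  define y where "y = yh r k"
  define x where "x = xh r k"
  have W: "W \<in> carrier_mat n k" and Z: "Z \<in> carrier_mat n k" and bh: "bh r \<in> carrier_vec n"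
    and y: "y \<in> carrier_vec k" and x: "x \<in> carrier_vec n"
    using dims k by (auto simp: run_dims_def W_def Z_def y_def x_def first_cols_carrier)
  show \<gamma>: "1 \<le> \<gamma>" using \<epsilon> by (simp add: \<gamma>_def)
  then have \<beta>: "1 \<le> \<beta>" "\<beta> \<le> \<gamma>" "\<beta> * \<beta> = \<gamma>"
    using mult_left_mono[of 1 \<beta> \<beta>] by (simp_all add: \<beta>_def)
  have K: "1 \<le> K" "K \<le> real k" "K * K = real k"
    using k mult_left_mono[of 1 K K] by (simp_all add: K_def)
  have \<mu>: "0 \<le> \<mu>" and \<eta>: "0 \<le> \<eta>" using nonneg by (simp_all add: \<mu>_def \<eta>_def)

  have n0: "0 < n" using n by simp
  note condM = spec_norm_mult_inv_le_cond[OF M n0]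
  show "cond M = ereal \<kappa>L" and \<kappa>L: "1 \<le> \<kappa>L" using condM by (simp_all add: \<kappa>L_def)
  have "cond Z \<noteq> \<infinity>" using crit by (simp add: critical_iteration_def Z_def)
  moreover have "0 < dim_col Z" using Z k by simp
  ultimately have sZ: "0 < sigma_min Z" and condZ: "cond Z = ereal \<kappa>Z" and \<kappa>Z: "1 \<le> \<kappa>Z"
    using cond_finiteD[of Z] by (simp_all add: \<kappa>Z_def)
  then show "cond Z = ereal \<kappa>Z" "1 \<le> \<kappa>Z" by simp_all
  have "ex e * \<kappa>Z \<le> 1 / 2" using crit condZ by (simp add: critical_iteration_def Z_def)
  moreover have dx: "vnorm (x - Z *\<^sub>v y) \<le> ex e * spec_norm Z * vnorm y"
    using model k by (simp add: rounding_model_def rounding_x_def x_def Z_def y_def)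
  ultimately have Zy: "spec_norm Z * vnorm y \<le> 2 * \<kappa>Z * vnorm x"
    unfolding \<kappa>Z_def by (intro spec_norm_times_coordinates_le[OF Z k(1) y x _ sZ])

  have "\<And>j. j < m \<Longrightarrow> rounding_C S (eS e) r j" "rounding_g S (eS e) r" "rounding_LS (esls e) r k"
    using model k by (auto simp: rounding_model_def)
  note pre = critical_preconditioned_residual_le[OF dims k \<epsilon> nonneg(3,4) this crit sketch,
      folded \<eta>_def \<mu>_def \<gamma>_def W_def y_def, folded \<beta>_def K_def]
  have \<beta>\<mu>K: "\<mu> * \<beta> \<le> K * \<mu> * \<beta>" "\<mu> \<le> \<mu> * \<beta>"
    using K(1) \<mu> \<beta>(1) mult_right_mono[of 1 K "\<mu> * \<beta>"] mult_left_mono[of 1 \<beta> \<mu>] by simp_all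
  with pre(2) show "\<mu> \<le> 1 / 192" by linarith

  define Mi where "Mi = spec_norm (mat_inv M)"
  define P where "P = frob_norm A * frob_norm Z"
  have Mi: "0 \<le> Mi" unfolding Mi_def using mat_inv_props[OF M] n by (intro spec_norm_nonneg) auto
  have Ml: "0 \<le> spec_norm M" using M n by (intro spec_norm_nonneg) auto
  have MM: "spec_norm M * Mi \<le> \<kappa>L" using condM by (simp add: \<kappa>L_def Mi_def)
  have P: "0 \<le> P" by (simp add: P_def)

  have dW: "frob_norm (W - mat_inv M * A * Z) \<le> eW e * Mi * P"
    using model k by (simp add: rounding_model_def rounding_W_def W_def Z_def P_def Mi_def mult.assoc)
  have db: "vnorm (bh r - mat_inv M *\<^sub>v b) \<le> eb e * Mi * vnorm b"
    using model by (simp add: rounding_model_def rounding_b_def Mi_def)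
  have bh_le: "vnorm (bh r) \<le> (1 + eb e) * Mi * vnorm b"
  proof -
    have I: "mat_inv M \<in> carrier_mat n n" using mat_inv_props[OF M] by simp
    have "vnorm (mat_inv M *\<^sub>v b) \<le> Mi * vnorm b"
      unfolding Mi_def using I b by (intro vnorm_mult_le_spec_norm) auto
    with db show ?thesis
      using vnorm_le_add_diff[OF bh mult_mat_vec_carrier[OF I b]] by (simp add: algebra_simps)
  qed
  have W_le: "spec_norm W \<le> (1 + eW e) * Mi * P"
  proof -
    have I: "mat_inv M \<in> carrier_mat n n" using mat_inv_props[OF M] by simp
    have "frob_norm (mat_inv M * A * Z) \<le> Mi * frob_norm (A * Z)"
      unfolding Mi_def assoc_mult_mat[OF I A Z] using I A n by (intro frob_norm_mult_le) auto
    also have "frob_norm (A * Z) \<le> spec_norm A * frob_norm Z"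
      using A Z n by (intro frob_norm_mult_le) auto
    also have "spec_norm A * frob_norm Z \<le> P"
      unfolding P_def using A n by (intro mult_right_mono spec_norm_le_frob_norm) auto
    finally have "frob_norm (mat_inv M * A * Z) \<le> Mi * P" using Mi by (simp add: mult_left_mono)
    moreover have "spec_norm W \<le> frob_norm W" using W k by (intro spec_norm_le_frob_norm) auto
    moreover have "mat_inv M * A * Z \<in> carrier_mat n k" using I A Z by simp
    ultimately show ?thesis
      using frob_norm_add_le[OF W, of "mat_inv M * A * Z"] dW by (simp add: algebra_simps)
  qed

  define U where "U = frob_norm A * (spec_norm Z * vnorm y)"
  have U0: "0 \<le> U" using spec_norm_nonneg[of Z] Z k by (simp add: U_def)
  have U: "U \<le> 2 * (\<kappa>Z * (frob_norm A * vnorm x))"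
    using mult_left_mono[OF Zy, of "frob_norm A"] by (simp add: U_def mult_ac)
  have PU: "P * vnorm y \<le> K * U"
  proof -
    have "frob_norm Z \<le> K * spec_norm Z"
      using frob_norm_le_spec_norm[of Z] Z k by (simp add: K_def)
    then have "frob_norm A * vnorm y * frob_norm Z \<le> frob_norm A * vnorm y * (K * spec_norm Z)"
      by (rule mult_left_mono) simp
    then show ?thesis by (simp add: P_def U_def mult_ac)
  qed

  have part1: "vnorm (bh r - W *\<^sub>v y)
      \<le> Mi * ((194 * (\<gamma> * \<mu>) + 2 * eW e) * (real k * U) + \<gamma> * (1 + eb e) * \<eta> * vnorm b)"
  proof -
    have "194 * (K * \<mu> * \<beta>) * spec_norm W * vnorm y
        \<le> 194 * (K * \<mu> * \<beta>) * ((1 + eW e) * Mi * P) * vnorm y"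
      using W_le K \<mu> \<beta> by (intro mult_right_mono mult_left_mono) auto
    also have "\<dots> = 194 * (K * \<mu> * \<beta>) * (1 + eW e) * Mi * (P * vnorm y)" by (simp add: mult_ac)
    also have "\<dots> \<le> 194 * (K * \<mu> * \<beta>) * (1 + eW e) * Mi * (K * U)"
      using PU K \<mu> \<beta> nonneg Mi by (intro mult_left_mono) auto
    also have "\<dots> = Mi * (194 * (\<mu> * \<beta>) * (real k * U) + 194 * (K * \<mu> * \<beta>) * (eW e * (K * U)))"
      by (simp add: K(3)[symmetric] algebra_simps)
    also have "\<dots> \<le> Mi * (194 * (\<gamma> * \<mu>) * (real k * U) + 2 * (eW e * (real k * U)))"
    proof (intro mult_left_mono add_mono)
      have "\<mu> * \<beta> \<le> \<mu> * \<gamma>" using \<beta> \<mu> by (intro mult_left_mono) auto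
      then show "194 * (\<mu> * \<beta>) * (real k * U) \<le> 194 * (\<gamma> * \<mu>) * (real k * U)"
        using U0 by (intro mult_right_mono) (auto simp: mult.commute)
      have "K * U \<le> real k * U" using K U0 by (intro mult_right_mono) auto
      then have "eW e * (K * U) \<le> eW e * (real k * U)" using nonneg by (intro mult_left_mono) auto
      moreover have "194 * (K * \<mu> * \<beta>) \<le> 2" using pre(2) by linarith
      ultimately show "194 * (K * \<mu> * \<beta>) * (eW e * (K * U)) \<le> 2 * (eW e * (real k * U))"
        using nonneg K U0 by (intro mult_mono) auto
    qed (rule Mi)
    finally have first: "194 * (K * \<mu> * \<beta>) * spec_norm W * vnorm y
        \<le> Mi * (194 * (\<gamma> * \<mu>) * (real k * U) + 2 * (eW e * (real k * U)))" .
    have "\<eta> * \<beta> * vnorm (bh r) \<le> \<eta> * \<gamma> * ((1 + eb e) * Mi * vnorm b)"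
      using bh_le \<beta> \<eta> by (intro mult_mono mult_left_mono) auto
    with first pre(1) show ?thesis by (simp add: algebra_simps)
  qed

  have "vnorm (b - A *\<^sub>v x)
      \<le> spec_norm M * (vnorm (bh r - W *\<^sub>v y) + vnorm (bh r - mat_inv M *\<^sub>v b)
          + frob_norm (W - mat_inv M * A * Z) * vnorm y) + frob_norm A * vnorm (x - Z *\<^sub>v y)"
    by (rule true_residual_le[OF A M n b bh W Z y x])
  also have "\<dots> \<le> spec_norm M * (Mi * ((194 * (\<gamma> * \<mu>) + 2 * eW e) * (real k * U)
      + \<gamma> * (1 + eb e) * \<eta> * vnorm b) + eb e * Mi * vnorm b + eW e * Mi * (real k * U)) + ex e * U"
  proof (intro add_mono mult_left_mono part1 db Ml)
    have "frob_norm (W - mat_inv M * A * Z) * vnorm y \<le> eW e * Mi * P * vnorm y"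
      using dW by (rule mult_right_mono) simp
    also have "\<dots> = eW e * Mi * (P * vnorm y)" by simp
    also have "\<dots> \<le> eW e * Mi * (real k * U)"
    proof (rule mult_left_mono)
      show "P * vnorm y \<le> real k * U" using PU mult_right_mono[OF K(2) U0] by linarith
    qed (use nonneg Mi in simp)
    finally show "frob_norm (W - mat_inv M * A * Z) * vnorm y \<le> eW e * Mi * (real k * U)" .
    show "frob_norm A * vnorm (x - Z *\<^sub>v y) \<le> ex e * U"
      using mult_left_mono[OF dx, of "frob_norm A"] by (simp add: U_def mult_ac)
  qed
  also have "\<dots> = (spec_norm M * Mi) * ((194 * (\<gamma> * \<mu>) + 3 * eW e) * (real k * U)
      + (\<gamma> * (1 + eb e) * \<eta> + eb e) * vnorm b) + ex e * U"
    by (simp add: algebra_simps)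
  also have "\<dots> \<le> \<kappa>L * ((194 * (\<gamma> * \<mu>) + 3 * eW e) * (real k * U)
      + (\<gamma> * (1 + eb e) * \<eta> + eb e) * vnorm b) + \<kappa>L * (ex e * (real k * U))"
  proof (rule add_mono)
    show "spec_norm M * Mi * ((194 * (\<gamma> * \<mu>) + 3 * eW e) * (real k * U)
        + (\<gamma> * (1 + eb e) * \<eta> + eb e) * vnorm b)
      \<le> \<kappa>L * ((194 * (\<gamma> * \<mu>) + 3 * eW e) * (real k * U)
        + (\<gamma> * (1 + eb e) * \<eta> + eb e) * vnorm b)"
      using MM \<gamma> \<mu> \<eta> nonneg U0 by (intro mult_right_mono) auto
    have "1 * U \<le> real k * U" using k U0 by (intro mult_right_mono) auto
    then have "ex e * U \<le> ex e * (real k * U)" using nonneg by (intro mult_left_mono) auto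
    also have "\<dots> \<le> \<kappa>L * (ex e * (real k * U))"
      using \<kappa>L mult_right_mono[of 1 \<kappa>L "ex e * (real k * U)"] nonneg U0 by simp
    finally show "ex e * U \<le> \<kappa>L * (ex e * (real k * U))" .
  qed
  also have "\<dots> \<le> \<kappa>L * (200 * (\<gamma> * \<mu> + eW e + ex e) * (real k * U))
      + (\<gamma> * (1 + eb e) * \<eta> + eb e) * \<kappa>L * vnorm b"
  proof -
    have "194 * (\<gamma> * \<mu>) + 3 * eW e + ex e \<le> 200 * (\<gamma> * \<mu> + eW e + ex e)"
      using nonneg \<gamma> \<mu> by simp
    then have "(194 * (\<gamma> * \<mu>) + 3 * eW e + ex e) * (real k * U)
        \<le> 200 * (\<gamma> * \<mu> + eW e + ex e) * (real k * U)"
      using U0 by (intro mult_right_mono) auto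
    then have "\<kappa>L * ((194 * (\<gamma> * \<mu>) + 3 * eW e + ex e) * (real k * U))
        \<le> \<kappa>L * (200 * (\<gamma> * \<mu> + eW e + ex e) * (real k * U))"
      using \<kappa>L by (intro mult_left_mono) auto
    then show ?thesis by (simp add: algebra_simps)
  qed
  also have "\<kappa>L * (200 * (\<gamma> * \<mu> + eW e + ex e) * (real k * U))
      \<le> \<kappa>L * (200 * (\<gamma> * \<mu> + eW e + ex e) * (real k * (2 * (\<kappa>Z * (frob_norm A * vnorm x)))))"
    using U \<kappa>L \<gamma> \<mu> nonneg by (intro mult_left_mono) auto
  finally show "vnorm (b - A *\<^sub>v xh r k)
      \<le> 400 * real k * (\<gamma> * \<mu> + eW e + ex e) * \<kappa>L * \<kappa>Z * (frob_norm A * vnorm (xh r k))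
        + (\<gamma> * (1 + eb e) * \<eta> + eb e) * \<kappa>L * vnorm b"
    by (simp add: x_def algebra_simps)
qed

section \<open>The two error bounds\<close>

lemma implication_with_prob:
  assumes "\<And>S. S \<in> space D \<Longrightarrow> P S \<Longrightarrow> Q S"
  shows "(\<forall>S\<in>space D. P S \<longrightarrow> Q S) \<and> (\<forall>q. holds_with_prob D q P \<longrightarrow> holds_with_prob D q Q)"
proof (intro conjI allI impI ballI)
  fix q assume "holds_with_prob D q P"
  then obtain E where E: "E \<in> sets D" "q \<le> measure D E" "\<forall>S\<in>E. P S"
    by (auto simp: holds_with_prob_def)
  moreover have "\<forall>S\<in>E. Q S" using E assms sets.sets_into_space by blast
  ultimately show "holds_with_prob D q Q" by (auto simp: holds_with_prob_def)
qed (use assms in blast)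

text \<open>Only \<open>\<epsilon>\<^sub>b\<close> multiplies another parameter without being known to be small; the product is linear in
  the bound \<open>t\<close> nevertheless, because the other factor is at most 1 at a critical iteration.\<close>

lemma coefficients_le_unit_roundoff:
  fixes e :: rounding_params
  assumes small: "\<forall>\<delta>\<in>{eW e, eb e, esls e, eS e, ex e}. \<delta> \<le> t"
    and nonneg: "0 \<le> eb e" "0 \<le> esls e" "0 \<le> eS e"
    and \<gamma>: "1 \<le> \<gamma>" and \<mu>: "eS e + esls e \<le> 1 / 192"
  shows "\<gamma> * (eS e + esls e) + eW e + ex e \<le> \<gamma> * (4 * t)"
    and "\<gamma> * (1 + eb e) * (esls e + (1 + esls e) * eS e) + eb e \<le> \<gamma> * (6 * t)"
proof -
  let ?\<eta> = "esls e + (1 + esls e) * eS e"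
  have t: "0 \<le> t" using small nonneg(1) by auto
  have \<gamma>t: "t \<le> \<gamma> * t" using mult_right_mono[OF \<gamma> t] by simp
  have "\<gamma> * (eS e + esls e) \<le> \<gamma> * (2 * t)" using small \<gamma> by (intro mult_left_mono) auto
  with small \<gamma>t show "\<gamma> * (eS e + esls e) + eW e + ex e \<le> \<gamma> * (4 * t)" by simp
  have "esls e * eS e \<le> 1 * eS e" using \<mu> nonneg by (intro mult_right_mono) auto
  then have \<eta>: "?\<eta> \<le> 2 * (eS e + esls e)" using nonneg by (simp add: algebra_simps)
  then have "eb e * ?\<eta> \<le> eb e * 1" using \<mu> nonneg by (intro mult_left_mono) auto
  moreover have "?\<eta> \<le> 4 * t" using \<eta> small by auto
  moreover have "(1 + eb e) * ?\<eta> = ?\<eta> + eb e * ?\<eta>" by (simp add: algebra_simps)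
  moreover have "eb e \<le> t" using small by simp
  ultimately have "(1 + eb e) * ?\<eta> \<le> 5 * t" by linarith
  then have "\<gamma> * ((1 + eb e) * ?\<eta>) \<le> \<gamma> * (5 * t)" using \<gamma> by (intro mult_left_mono) auto
  with \<open>eb e \<le> t\<close> \<gamma>t show "\<gamma> * (1 + eb e) * ?\<eta> + eb e \<le> \<gamma> * (6 * t)" by (simp add: mult.assoc)
qed

lemma poly_fun_deg_linear: "bounded_linear f \<Longrightarrow> poly_fun_deg 2 (\<lambda>x. c * f x)"
  using poly_fun_deg.mult[OF poly_fun_deg.const poly_fun_deg.linear, of f 1 c] by (simp add: numeral_2_eq_2)

theorem theorem1:
  shows "\<exists>c1 c2 ct :: real \<times> real \<Rightarrow> real.
    low_degree_pos_poly c1 \<and> low_degree_pos_poly c2 \<and> low_degree_pos_poly ct \<and>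
    (\<forall>n s m A b ML MR \<epsilon> D e R k.
       sgmres_setting n s m A b ML MR \<epsilon> D e R \<and> 1 \<le> k \<and> k \<le> m \<longrightarrow>
       (let good = (\<lambda>S. critical_iteration (c1 (real n, real k)) (c2 (real n, real k)) \<epsilon> e (R S) k \<and>
                        sketch_event n \<epsilon> S (R S) k);
            bound = (\<lambda>S. ereal (vnorm (b - A *\<^sub>v xh (R S) k)) \<le>
              ereal (ct (real n, real k) * ((1 + \<epsilon>) / (1 - \<epsilon>) * (eS e + esls e) + eW e + ex e))
                * cond ML * cond (first_cols k (Zh (R S))) * ereal (frob_norm A * vnorm (xh (R S) k))
              + ereal ((1 + \<epsilon>) / (1 - \<epsilon>) * (1 + eb e) * (esls e + (1 + esls e) * eS e) + eb e)
                * cond ML * ereal (vnorm b))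
        in (\<forall>S\<in>space D. good S \<longrightarrow> bound S) \<and>
           (\<forall>q. holds_with_prob D q good \<longrightarrow> holds_with_prob D q bound))) \<and>
    (\<forall>d (p :: real \<times> real \<times> real \<times> real \<Rightarrow> real). poly_fun_deg d p \<longrightarrow>
      (\<exists>q :: real \<times> real \<times> real \<times> real \<Rightarrow> real. poly_fun_deg (d + 2) q \<and>
        (\<forall>n s m A b ML MR \<epsilon> D e R k u.
           sgmres_setting n s m A b ML MR \<epsilon> D e R \<and> 1 \<le> k \<and> k \<le> m \<and> 0 < u \<and> u < 1 \<and>
           (\<forall>\<delta>\<in>{eW e, eb e, esls e, eS e, ex e}. \<delta> \<le> p (real n, real m, real s, real k) * u) \<longrightarrow>
           (let good = (\<lambda>S. critical_iteration (c1 (real n, real k)) (c2 (real n, real k)) \<epsilon> e (R S) k \<and>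
                            sketch_event n \<epsilon> S (R S) k);
                bound = (\<lambda>S. ereal (vnorm (b - A *\<^sub>v xh (R S) k)) \<le>
                  ereal ((1 + \<epsilon>) / (1 - \<epsilon>) * (q (real n, real m, real s, real k) * u)) * cond ML
                  * (cond (first_cols k (Zh (R S))) * ereal (frob_norm A * vnorm (xh (R S) k))
                     + ereal (vnorm b)))
            in (\<forall>S\<in>space D. good S \<longrightarrow> bound S) \<and>
               (\<forall>q'. holds_with_prob D q' good \<longrightarrow> holds_with_prob D q' bound)))))"
proof (rule exI[of _ "\<lambda>_. 1"], rule exI[of _ "\<lambda>_. 96"], rule exI[of _ "\<lambda>x. 400 * snd x"],
    intro conjI allI impI)
  show "low_degree_pos_poly (\<lambda>_. 1)" "low_degree_pos_poly (\<lambda>_. 96)"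
    by (simp_all add: low_degree_pos_poly_def poly_fun_deg.const)
  show "low_degree_pos_poly (\<lambda>x. 400 * snd x)"
    by (simp add: low_degree_pos_poly_def poly_fun_deg_linear bounded_linear_snd)
next
  fix n s m A b MM MR \<epsilon> D e R and k :: nat
  assume "sgmres_setting n s m A b MM MR \<epsilon> D e R \<and> 1 \<le> k \<and> k \<le> m"
  then have run: "sgmres_setting n s m A b MM MR \<epsilon> D e R" "1 \<le> k" "k \<le> m" by auto
  show "let good = (\<lambda>S. critical_iteration 1 96 \<epsilon> e (R S) k \<and> sketch_event n \<epsilon> S (R S) k);
            bound = (\<lambda>S. ereal (vnorm (b - A *\<^sub>v xh (R S) k)) \<le>
              ereal (400 * snd (real n, real k) * ((1 + \<epsilon>) / (1 - \<epsilon>) * (eS e + esls e) + eW e + ex e))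
                * cond MM * cond (first_cols k (Zh (R S))) * ereal (frob_norm A * vnorm (xh (R S) k))
              + ereal ((1 + \<epsilon>) / (1 - \<epsilon>) * (1 + eb e) * (esls e + (1 + esls e) * eS e) + eb e)
                * cond MM * ereal (vnorm b))
        in (\<forall>S\<in>space D. good S \<longrightarrow> bound S) \<and>
           (\<forall>q. holds_with_prob D q good \<longrightarrow> holds_with_prob D q bound)"
    unfolding Let_def
  proof (rule implication_with_prob)
    fix S assume S: "S \<in> space D"
      and good: "critical_iteration 1 96 \<epsilon> e (R S) k \<and> sketch_event n \<epsilon> S (R S) k"
    note err = critical_iteration_error[OF run(1) S refl run(2,3) conjunct1[OF good] conjunct2[OF good]]
    show "ereal (vnorm (b - A *\<^sub>v xh (R S) k)) \<le>
        ereal (400 * snd (real n, real k) * ((1 + \<epsilon>) / (1 - \<epsilon>) * (eS e + esls e) + eW e + ex e))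
          * cond MM * cond (first_cols k (Zh (R S))) * ereal (frob_norm A * vnorm (xh (R S) k))
        + ereal ((1 + \<epsilon>) / (1 - \<epsilon>) * (1 + eb e) * (esls e + (1 + esls e) * eS e) + eb e)
          * cond MM * ereal (vnorm b)"
      unfolding err(1,2) using err(7) by simp
  qed
next
  fix d and p :: "real \<times> real \<times> real \<times> real \<Rightarrow> real"
  assume p: "poly_fun_deg d p"
  \<comment> \<open>\<open>1600 = 400 \<cdot> 4\<close> and \<open>6\<close> are the coefficients of the terms in \<open>\<parallel>x\<parallel>\<close> and in \<open>\<parallel>b\<parallel>\<close>\<close>
  define q where "q = (\<lambda>x :: real \<times> real \<times> real \<times> real. p x * (1600 * snd (snd (snd x)) + 6))"
  have "poly_fun_deg 2 (\<lambda>x :: real \<times> real \<times> real \<times> real. 1600 * snd (snd (snd x)) + 6)"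
    by (intro poly_fun_deg.add poly_fun_deg_linear poly_fun_deg.const bounded_linear_intros)
  then have q: "poly_fun_deg (d + 2) q" unfolding q_def by (rule poly_fun_deg.mult[OF p])
  show "\<exists>q :: real \<times> real \<times> real \<times> real \<Rightarrow> real. poly_fun_deg (d + 2) q \<and>
        (\<forall>n s m A b ML MR \<epsilon> D e R k u.
           sgmres_setting n s m A b ML MR \<epsilon> D e R \<and> 1 \<le> k \<and> k \<le> m \<and> 0 < u \<and> u < 1 \<and>
           (\<forall>\<delta>\<in>{eW e, eb e, esls e, eS e, ex e}. \<delta> \<le> p (real n, real m, real s, real k) * u) \<longrightarrow>
           (let good = (\<lambda>S. critical_iteration 1 96 \<epsilon> e (R S) k \<and> sketch_event n \<epsilon> S (R S) k);
                bound = (\<lambda>S. ereal (vnorm (b - A *\<^sub>v xh (R S) k)) \<le>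
                  ereal ((1 + \<epsilon>) / (1 - \<epsilon>) * (q (real n, real m, real s, real k) * u)) * cond ML
                  * (cond (first_cols k (Zh (R S))) * ereal (frob_norm A * vnorm (xh (R S) k))
                     + ereal (vnorm b)))
            in (\<forall>S\<in>space D. good S \<longrightarrow> bound S) \<and>
               (\<forall>q'. holds_with_prob D q' good \<longrightarrow> holds_with_prob D q' bound)))"
    unfolding Let_def
  proof (rule exI[of _ q], intro conjI[OF q] allI impI, rule implication_with_prob)
    fix n s m A b MM MR \<epsilon> D e R and k :: nat and u :: real and S
    assume asm: "sgmres_setting n s m A b MM MR \<epsilon> D e R \<and> 1 \<le> k \<and> k \<le> m \<and> 0 < u \<and> u < 1 \<and>
           (\<forall>\<delta>\<in>{eW e, eb e, esls e, eS e, ex e}. \<delta> \<le> p (real n, real m, real s, real k) * u)"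
      and S: "S \<in> space D"
      and good: "critical_iteration 1 96 \<epsilon> e (R S) k \<and> sketch_event n \<epsilon> S (R S) k"
    from asm have run: "sgmres_setting n s m A b MM MR \<epsilon> D e R" "1 \<le> k" "k \<le> m" and u: "0 < u"
      and small: "\<forall>\<delta>\<in>{eW e, eb e, esls e, eS e, ex e}. \<delta> \<le> p (real n, real m, real s, real k) * u"
      by auto
    note err = critical_iteration_error[OF run(1) S refl run(2,3) conjunct1[OF good] conjunct2[OF good]]
    define \<gamma> where "\<gamma> = (1 + \<epsilon>) / (1 - \<epsilon>)"
    define t where "t = p (real n, real m, real s, real k) * u"
    define \<kappa>L where "\<kappa>L = spec_norm MM / sigma_min MM"
    define X where "X = spec_norm (first_cols k (Zh (R S))) / sigma_min (first_cols k (Zh (R S)))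
      * (frob_norm A * vnorm (xh (R S) k))"
    have nonneg: "0 \<le> eb e" "0 \<le> esls e" "0 \<le> eS e" using run(1) by (auto simp: sgmres_setting_def)
    have \<gamma>: "1 \<le> \<gamma>" and \<kappa>L: "1 \<le> \<kappa>L" using err(3,5) by (simp_all add: \<gamma>_def \<kappa>L_def)
    have X: "0 \<le> X" unfolding X_def using err(4) by (intro mult_nonneg_nonneg) auto
    have t: "0 \<le> t" using small nonneg(1) by (auto simp: t_def)
    note coeff = coefficients_le_unit_roundoff[OF small nonneg \<gamma> err(6), folded t_def]
    have "vnorm (b - A *\<^sub>v xh (R S) k)
        \<le> 400 * real k * (\<gamma> * (eS e + esls e) + eW e + ex e) * (\<kappa>L * X)
          + (\<gamma> * (1 + eb e) * (esls e + (1 + esls e) * eS e) + eb e) * (\<kappa>L * vnorm b)"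
      using err(7) by (simp add: \<gamma>_def \<kappa>L_def X_def mult_ac)
    also have "\<dots> \<le> 400 * real k * (\<gamma> * (4 * t)) * (\<kappa>L * X) + \<gamma> * (6 * t) * (\<kappa>L * vnorm b)"
      using coeff \<kappa>L X by (intro add_mono mult_right_mono mult_left_mono) auto
    also have "\<dots> \<le> (1600 * real k + 6) * (\<gamma> * t) * (\<kappa>L * X)
        + (1600 * real k + 6) * (\<gamma> * t) * (\<kappa>L * vnorm b)"
    proof (rule add_mono)
      show "400 * real k * (\<gamma> * (4 * t)) * (\<kappa>L * X) \<le> (1600 * real k + 6) * (\<gamma> * t) * (\<kappa>L * X)"
        using \<gamma> t \<kappa>L X by (intro mult_right_mono) (auto simp: algebra_simps)
      show "\<gamma> * (6 * t) * (\<kappa>L * vnorm b) \<le> (1600 * real k + 6) * (\<gamma> * t) * (\<kappa>L * vnorm b)"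
        using \<gamma> t \<kappa>L by (intro mult_right_mono) (auto simp: algebra_simps)
    qed
    also have "\<dots> = \<gamma> * (q (real n, real m, real s, real k) * u) * \<kappa>L * (X + vnorm b)"
      by (simp add: q_def t_def algebra_simps)
    finally show "ereal (vnorm (b - A *\<^sub>v xh (R S) k)) \<le>
        ereal ((1 + \<epsilon>) / (1 - \<epsilon>) * (q (real n, real m, real s, real k) * u)) * cond MM
        * (cond (first_cols k (Zh (R S))) * ereal (frob_norm A * vnorm (xh (R S) k)) + ereal (vnorm b))"
      unfolding err(1,2) by (simp add: \<gamma>_def \<kappa>L_def X_def)
  qed
qed

end
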